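(* Consider the linear Gaussian model $\mathbf{Y}=\widetilde{\mathbf{X}}\mathbf{H}+\mathbf{V}$ with the joint-sparse parameterized prior on $\mathbf{H}\in\mathbb{C}^{NMR\times K}$ described in the context, with hyperparameters $\tilde{\boldsymbol\psi}=(\tilde\psi_1,\dots,\tilde\psi_R)\in(0,\infty)^R$ and $\mathbf{\Psi}_J=\mathbf{I}_M\otimes(\mathbf{I}_N\otimes\mathrm{diag}[\tilde\psi_1,\dots,\tilde\psi_R])$. Fix an observation $\mathbf{Y}\in\mathbb{C}^{M(L+R-1)\times K}$. Let $l\ge1$, let the previous estimates $\widehat{\tilde\psi}_i^{(l-1)}>0$, $1\le i\le R$, be given, put $\widehat{\mathbf{\Psi}}_J^{(l-1)}=\mathbf{I}_M\otimes(\mathbf{I}_N\otimes\mathrm{diag}[\widehat{\tilde\psi}_1^{(l-1)},\dots,\widehat{\tilde\psi}_R^{(l-1)}])$, and define $$\bar{\mathbf{\Sigma}}_J^{(l)}=\left(\widetilde{\mathbf{X}}^H\mathbf{R}_v^{-1}\widetilde{\mathbf{X}}+\left(\widehat{\mathbf{\Psi}}_J^{(l-1)}\right)^{-1}\right)^{-1},\qquad \bar{\boldsymbol{\mathcal{M}}}_J^{(l)}=\bar{\mathbf{\Sigma}}_J^{(l)}\widetilde{\mathbf{X}}^H\mathbf{R}_v^{-1}\mathbf{Y}.$$ Then the hyperparameters $\widehat{\tilde{\boldsymbol\psi}}^{(l)}$ that maximize, over $\tilde{\boldsymbol\psi}\in(0,\infty)^R$, the EM objective $$\mathbb{E}_{\mathbf{H}|\mathbf{Y};\widehat{\mathbf{\Psi}}_J^{(l-1)}}\left\{\log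 p\left(\mathbf{Y},\mathbf{H};\mathbf{\Psi}_J\right)\right\}$$ are given, for each $1\le i\le R$, by $$\widehat{\tilde\psi}_i^{(l)}=\frac{1}{NMK}\sum_{n=1}^{N}\sum_{m=1}^{M}\sum_{k=1}^{K}\left|\bar{\boldsymbol{\mathcal{M}}}_J^{(l)}(\bar m+i,k)\right|^2+\frac{1}{NM}\sum_{n=1}^{N}\sum_{m=1}^{M}\bar{\mathbf{\Sigma}}_J^{(l)}(\bar m+i,\bar m+i),$$ where $\bar m=\bar m(m,n)=(m-1)NR+(n-1)R$.
   Context: $N,M,R,K,L$ are positive integers (numbers of transmit antennas, receive antennas, range bins, pulses, and transmit samples). For each $n=1,\dots,N$, given complex numbers $x_n[1],\dots,x_n[L]$, $\mathbf{X}_n\in\mathbb{C}^{(L+R-1)\times R}$ is the Toeplitz convolution matrix with $(a,b)$ entry $x_n[a-b+1]$ when $1\le a-b+1\le L$ and $0$ otherwise. $\mathbf{X}=[\mathbf{X}_1,\dots,\mathbf{X}_N]\in\mathbb{C}^{(L+R-1)\times NR}$ and $\widetilde{\mathbf{X}}=\mathbf{I}_M\otimes\mathbf{X}\in\mathbb{C}^{M(L+R-1)\times NMR}$. Observation model: $\mathbf{Y}=\widetilde{\mathbf{X}}\mathbf{H}+\mathbf{V}$, where the columns of $\mathbf{V}\in\mathbb{C}^{M(L+R-1)\times K}$ are independent circularly symmetric complex Gaussian $\mathcal{CN}(\mathbf{0},\mathbf{R}_v)$ vectors with $\mathbf{R}_v$ a (known) Hermitian positive definite matrix, independent of $\mathbf{H}$.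 Thus $p(\mathbf{Y}|\mathbf{H})$ is the corresponding Gaussian density and does not depend on the hyperparameters. Channel vectors: the $k$-th column of $\mathbf{H}$ is obtained by stacking vectors $\mathbf{h}_{n,m,k}\in\mathbb{C}^R$, first over the transmit index $n=1,\dots,N$ and then over the receive index $m=1,\dots,M$; that is, $\mathbf{h}_{n,m,k}(i)=\mathbf{H}((m-1)NR+(n-1)R+i,\,k)$ for $1\le i\le R$. Joint-sparse prior: the density of $\mathbf{H}$ with respect to Lebesgue measure on $\mathbb{C}^{NMR\times K}$ is $$p(\mathbf{H};\mathbf{\Psi}_J)=\prod_{n=1}^{N}\prod_{m=1}^{M}\prod_{k=1}^{K}\prod_{i=1}^{R}(\pi\tilde\psi_i)^{-1}\exp\left(-\frac{|\mathbf{h}_{n,m,k}(i)|^2}{\tilde\psi_i}\right).$$ The joint density is $p(\mathbf{Y},\mathbf{H};\mathbf{\Psi}_J)=p(\mathbf{Y}|\mathbf{H})\,p(\mathbf{H};\mathbf{\Psi}_J)$, and $\mathbb{E}_{\mathbf{H}|\mathbf{Y};\widehat{\mathbf{\Psi}}_J^{(l-1)}}\{\cdot\}$ denotes expectation over $\mathbf{H}$ under its posterior (conditional) distribution given $\mathbf{Y}$ in the model with hyperparameter matrix $\widehat{\mathbf{\Psi}}_J^{(l-1)}$. $\bar{\mathbf{\Sigma}}_J^{(l)}$ and $\bar{\boldsymbol{\mathcal{M}}}_J^{(l)}$ are called the posterior covariance and mean matrices. *)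

theory Defs
  imports
    "HOL-Probability.Probability"
    "Jordan_Normal_Form.Schur_Decomposition"
begin

unbundle no vec_syntax

text \<open>
  All indices start at 0. Thus \<open>x n t\<close> (\<open>n < N\<close>, \<open>t < L\<close>) is the sample numbered \<open>t + 1\<close> of the
  transmit antenna numbered \<open>n + 1\<close>, and the block offset of the pair \<open>(m, n)\<close> is
  \<open>m * (N * R) + n * R\<close>. Matrices and vectors are those of Jordan_Normal_Form, since the dimensions
  are arithmetic expressions in \<open>N, M, R, K, L\<close>.
\<close>

definition conv_mat :: "nat \<Rightarrow> nat \<Rightarrow> (nat \<Rightarrow> complex) \<Rightarrow> complex Matrix.mat" where
  "conv_mat L R s =
     Matrix.mat (L + R - 1) R (\<lambda>(a, b). if b \<le> a \<and> a - b < L then s (a - b) else 0)"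

definition transmit_mat :: "nat \<Rightarrow> nat \<Rightarrow> nat \<Rightarrow> (nat \<Rightarrow> nat \<Rightarrow> complex) \<Rightarrow> complex Matrix.mat" where
  "transmit_mat N R L x =
     Matrix.mat (L + R - 1) (N * R) (\<lambda>(a, j). conv_mat L R (x (j div R)) $$ (a, j mod R))"

definition kron :: "complex Matrix.mat \<Rightarrow> complex Matrix.mat \<Rightarrow> complex Matrix.mat"  (infixr "\<otimes>\<^sub>K" 70) where
  "A \<otimes>\<^sub>K B =
     Matrix.mat (dim_row A * dim_row B) (dim_col A * dim_col B)
       (\<lambda>(i, j). A $$ (i div dim_row B, j div dim_col B) * B $$ (i mod dim_row B, j mod dim_col B))"

text \<open>Only meaningful for invertible matrices; \<open>mat_inverse\<close> returns \<open>None\<close> otherwise.\<close>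

definition mat_inv :: "complex Matrix.mat \<Rightarrow> complex Matrix.mat" where
  "mat_inv A = the (mat_inverse A)"

definition hermitian_pos_def :: "nat \<Rightarrow> complex Matrix.mat \<Rightarrow> bool" where
  "hermitian_pos_def d A \<longleftrightarrow>
     A \<in> carrier_mat d d \<and> mat_adjoint A = A \<and>
     (\<forall>v \<in> carrier_vec d. v \<noteq> 0\<^sub>v d \<longrightarrow> Re ((A *\<^sub>v v) \<bullet>c v) > 0)"

definition pos_vecs :: "nat \<Rightarrow> real Matrix.vec set" where
  "pos_vecs R = {psi \<in> carrier_vec R. \<forall>i < R. psi $ i > 0}"

definition Psi_J :: "nat \<Rightarrow> nat \<Rightarrow> real Matrix.vec \<Rightarrow> complex Matrix.mat" where
  "Psi_J N M psi =
     1\<^sub>m M \<otimes>\<^sub>K (1\<^sub>m N \<otimes>\<^sub>K mat_diag (dim_vec psi) (\<lambda>i. complex_of_real (psi $ i)))"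

text \<open>
  Lebesgue measure on the complex \<open>r \<times> c\<close> matrices: the product of \<open>r * c\<close> copies of Lebesgue
  measure on the complex plane, transported along the bijection from coordinates to matrices.
\<close>

definition lborel_mat :: "nat \<Rightarrow> nat \<Rightarrow> complex Matrix.mat measure" where
  "lborel_mat r c =
     embed_measure (Pi\<^sub>M ({0..<r} \<times> {0..<c}) (\<lambda>_. (lborel :: complex measure))) (Matrix.mat r c)"

text \<open>
  Density of the circularly symmetric complex Gaussian with mean 0 and covariance \<open>C\<close>. As
  \<open>(B *\<^sub>v v) \<bullet>c v\<close> is the form \<open>v\<^sup>H B v\<close>, both real parts are taken of numbers that are real whenever
  \<open>C\<close> is Hermitian positive definite.
\<close>

definition cgauss_density :: "complex Matrix.mat \<Rightarrow> complex Matrix.vec \<Rightarrow> real" where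
  "cgauss_density C v =
     exp (- Re ((mat_inv C *\<^sub>v v) \<bullet>c v)) / (pi ^ dim_vec v * Re (Determinant.det C))"

definition noise_density :: "complex Matrix.mat \<Rightarrow> complex Matrix.mat \<Rightarrow> real" where
  "noise_density Rv V = (\<Prod>k < dim_col V. cgauss_density Rv (col V k))"

definition likelihood ::
    "complex Matrix.mat \<Rightarrow> complex Matrix.mat \<Rightarrow> complex Matrix.mat \<Rightarrow> complex Matrix.mat \<Rightarrow> real" where
  "likelihood Xt Rv Y H = noise_density Rv (Y - Xt * H)"

definition prior_density ::
    "nat \<Rightarrow> nat \<Rightarrow> real Matrix.vec \<Rightarrow> complex Matrix.mat \<Rightarrow> real" where
  "prior_density N M psi H =
     (let R = dim_vec psi in
      \<Prod>n < N. \<Prod>m < M. \<Prod>k < dim_col H. \<Prod>i < R.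
        inverse (pi * psi $ i) *
        exp (- (cmod (H $$ (m * (N * R) + n * R + i, k)))\<^sup>2 / psi $ i))"

definition joint_density ::
    "nat \<Rightarrow> nat \<Rightarrow> complex Matrix.mat \<Rightarrow> complex Matrix.mat \<Rightarrow> real Matrix.vec \<Rightarrow>
     complex Matrix.mat \<Rightarrow> complex Matrix.mat \<Rightarrow> real" where
  "joint_density N M Xt Rv psi Y H = likelihood Xt Rv Y H * prior_density N M psi H"

definition evidence ::
    "nat \<Rightarrow> nat \<Rightarrow> complex Matrix.mat \<Rightarrow> complex Matrix.mat \<Rightarrow> real Matrix.vec \<Rightarrow>
     complex Matrix.mat \<Rightarrow> ennreal" where
  "evidence N M Xt Rv psi Y =
     (\<integral>\<^sup>+ H. ennreal (joint_density N M Xt Rv psi Y H)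
        \<partial>lborel_mat (N * M * dim_vec psi) (dim_col Y))"

definition posterior ::
    "nat \<Rightarrow> nat \<Rightarrow> complex Matrix.mat \<Rightarrow> complex Matrix.mat \<Rightarrow> real Matrix.vec \<Rightarrow>
     complex Matrix.mat \<Rightarrow> complex Matrix.mat measure" where
  "posterior N M Xt Rv psi Y =
     density (lborel_mat (N * M * dim_vec psi) (dim_col Y))
       (\<lambda>H. ennreal (joint_density N M Xt Rv psi Y H) / evidence N M Xt Rv psi Y)"

definition em_objective ::
    "nat \<Rightarrow> nat \<Rightarrow> complex Matrix.mat \<Rightarrow> complex Matrix.mat \<Rightarrow> complex Matrix.mat \<Rightarrow>
     real Matrix.vec \<Rightarrow> real Matrix.vec \<Rightarrow> real" where
  "em_objective N M Xt Rv Y psi_prev psi =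
     (\<integral>H. ln (joint_density N M Xt Rv psi Y H) \<partial>posterior N M Xt Rv psi_prev Y)"

end

theory Submission
  imports Defs "HOL-Real_Asymp.Real_Asymp"
begin

text \<open>
  As a function of \<open>H\<close>, the joint density is a constant times
  \<open>exp (- (\<Sum>k. h\<^sub>k\<^sup>H A h\<^sub>k - 2 Re (b\<^sub>k\<^sup>H h\<^sub>k)))\<close>, where \<open>h\<^sub>k\<close> are the columns of \<open>H\<close>, \<open>A\<close> is the inverse of
  the posterior covariance and \<open>A\<^sup>-\<^sup>1 b\<^sub>k\<close> is the \<open>k\<close>-th column of the posterior mean. Its normalising
  constant is never computed: translation invariance of Lebesgue measure alone gives the moment
  generating functions of the real and imaginary parts of the entries of \<open>H\<close>, and hence
  \<open>E \<bar>H\<^sub>j\<^sub>k\<bar>\<^sup>2 = \<bar>Mu\<^sub>j\<^sub>k\<bar>\<^sup>2 + Sigma\<^sub>j\<^sub>j\<close>. Up to a term that does not depend on the hyperparameters, the EM objective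
  is then \<open>- (\<Sum>i. N M K ln \<psi>\<^sub>i + S\<^sub>i / \<psi>\<^sub>i)\<close>, where \<open>S\<^sub>i > 0\<close> is the sum of these second moments over
  the entries of the range bin \<open>i\<close>, and each summand has its unique minimum at \<open>\<psi>\<^sub>i = S\<^sub>i / (N M K)\<close>.
\<close>

section \<open>Hermitian forms\<close>

lemma mat_adjoint_index:
  "i < dim_col A \<Longrightarrow> j < dim_row A \<Longrightarrow> mat_adjoint A $$ (i, j) = conjugate (A $$ (j, i))"
  by (simp add: mat_adjoint_def mat_of_rows_def)

lemma mat_adjoint_carrier: "A \<in> carrier_mat p d \<Longrightarrow> mat_adjoint A \<in> carrier_mat d p"
  by (auto simp: mat_adjoint_def)

lemma cscalar_mat_adjoint:
  fixes A :: "complex Matrix.mat"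
  assumes "A \<in> carrier_mat p d" "v \<in> carrier_vec d" "w \<in> carrier_vec p"
  shows "(A *\<^sub>v v) \<bullet>c w = v \<bullet>c (mat_adjoint A *\<^sub>v w)"
proof -
  have "(A *\<^sub>v v) \<bullet>c w = (\<Sum>i = 0..<p. \<Sum>j = 0..<d. A $$ (i, j) * v $ j * cnj (w $ i))"
    using assms by (auto simp: scalar_prod_def sum_distrib_right)
  also have "\<dots> = (\<Sum>j = 0..<d. \<Sum>i = 0..<p. A $$ (i, j) * v $ j * cnj (w $ i))"
    by (rule sum.swap)
  also have "\<dots> = v \<bullet>c (mat_adjoint A *\<^sub>v w)"
    using assms mat_adjoint_carrier[OF assms(1)]
    by (auto simp: scalar_prod_def sum_distrib_left mat_adjoint_index algebra_simps intro!: sum.cong)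
  finally show ?thesis .
qed

lemma cscalar_mat_adjoint':
  fixes A :: "complex Matrix.mat"
  assumes "A \<in> carrier_mat p d" "v \<in> carrier_vec p" "w \<in> carrier_vec d"
  shows "(mat_adjoint A *\<^sub>v v) \<bullet>c w = v \<bullet>c (A *\<^sub>v w)"
proof -
  have "(mat_adjoint A *\<^sub>v v) \<bullet>c w = (\<Sum>j = 0..<d. \<Sum>i = 0..<p. cnj (A $$ (i, j)) * v $ i * cnj (w $ j))"
    using assms mat_adjoint_carrier[OF assms(1)] 
    by (auto simp: scalar_prod_def sum_distrib_right mat_adjoint_index)
  also have "\<dots> = (\<Sum>i = 0..<p. \<Sum>j = 0..<d. cnj (A $$ (i, j)) * v $ i * cnj (w $ j))"
    by (rule sum.swap)
  also have "\<dots> = v \<bullet>c (A *\<^sub>v w)"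
    using assms 
    by (auto simp: scalar_prod_def sum_distrib_left algebra_simps intro!: sum.cong)
  finally show ?thesis .
qed

lemma cnj_cscalar:
  fixes v w :: "complex Matrix.vec"
  assumes "v \<in> carrier_vec d" "w \<in> carrier_vec d"
  shows "cnj (v \<bullet>c w) = w \<bullet>c v"
  using assms by (auto simp: scalar_prod_def mult.commute intro!: sum.cong)

lemma hermitian_cscalar_swap:
  fixes A :: "complex Matrix.mat"
  assumes "A \<in> carrier_mat d d" "mat_adjoint A = A" "v \<in> carrier_vec d" "w \<in> carrier_vec d"
  shows "(A *\<^sub>v v) \<bullet>c w = cnj ((A *\<^sub>v w) \<bullet>c v)"
  using cscalar_mat_adjoint[OF assms(1,3,4)] cnj_cscalar[of "A *\<^sub>v w" d v] assms by simp

lemma conjugate_unit_vec: "conjugate (unit_vec d i :: complex Matrix.vec) = unit_vec d i"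
  by (rule eq_vecI) (auto simp: unit_vec_def)

text \<open>Inserting unit vectors in both arguments of the form reads off single entries.
  Self-adjointness of inverses and of sums of products can thus be shown through the form, without
  entrywise computation.\<close>

lemma mat_adjoint_eqI:
  fixes A :: "complex Matrix.mat"
  assumes A: "A \<in> carrier_mat d d"
    and sym: "\<And>v w. v \<in> carrier_vec d \<Longrightarrow> w \<in> carrier_vec d \<Longrightarrow> (A *\<^sub>v v) \<bullet>c w = v \<bullet>c (A *\<^sub>v w)"
  shows "mat_adjoint A = A"
proof (rule eq_matI)
  fix i j assume ij: "i < dim_row A" "j < dim_col A"
  have "(A *\<^sub>v unit_vec d j) \<bullet>c unit_vec d i = unit_vec d j \<bullet>c (A *\<^sub>v unit_vec d i)"
    by (rule sym) auto
  then show "mat_adjoint A $$ (i, j) = A $$ (i, j)"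
    using ij A by (simp add: mat_adjoint_index conjugate_unit_vec)
qed (use A in \<open>auto simp: mat_adjoint_def\<close>)

section \<open>Inverses and determinants of positive definite matrices\<close>

lemma mat_inv_of_det:
  assumes "A \<in> carrier_mat d d" "Determinant.det A \<noteq> 0"
  shows "mat_inv A \<in> carrier_mat d d" "A * mat_inv A = 1\<^sub>m d" "mat_inv A * A = 1\<^sub>m d"
proof -
  have "mat_inverse A \<noteq> None"
    using mat_inverse(1)[OF assms(1), of "()"] det_non_zero_imp_unit[OF assms, of "()"] by blast
  then have "mat_inverse A = Some (mat_inv A)"
    by (auto simp: mat_inv_def)
  from mat_inverse(2)[OF assms(1) this]
  show "mat_inv A \<in> carrier_mat d d" "A * mat_inv A = 1\<^sub>m d" "mat_inv A * A = 1\<^sub>m d"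
    by auto
qed

text \<open>A right inverse forces the determinants to multiply to 1. Hence \<open>det A\<close> is
  nonzero, \<open>mat_inverse\<close> does not return \<open>None\<close>, and associativity
  identifies the two inverses.\<close>

lemma mat_inv_eqI:
  assumes A: "A \<in> carrier_mat d d" and B: "B \<in> carrier_mat d d" and AB: "A * B = 1\<^sub>m d"
  shows "mat_inv A = B"
proof -
  have "Determinant.det A * Determinant.det B = 1"
    using det_mult[OF A B] AB by simp
  then have "Determinant.det A \<noteq> 0" by auto
  note inv = mat_inv_of_det[OF A this]
  have "mat_inv A = mat_inv A * (A * B)" using inv(1) AB by simp
  also have "\<dots> = mat_inv A * A * B" using inv(1) A B by (simp add: assoc_mult_mat)
  also have "\<dots> = B" using inv(3) B by simp
  finally show ?thesis .
qed

text \<open>A nonzero kernel vector would make the form vanish at that vector.\<close>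

lemma hermitian_pos_def_det_nonzero:
  assumes "hermitian_pos_def d A"
  shows "Determinant.det A \<noteq> 0"
proof
  assume "Determinant.det A = 0"
  moreover have A: "A \<in> carrier_mat d d" using assms by (simp add: hermitian_pos_def_def)
  ultimately obtain v where "v \<in> carrier_vec d" "v \<noteq> 0\<^sub>v d" "A *\<^sub>v v = 0\<^sub>v d"
    using det_0_iff_vec_prod_zero[OF A] by auto
  with assms show False by (force simp: hermitian_pos_def_def)
qed

lemmas hermitian_pos_def_inv =
  mat_inv_of_det[OF _ hermitian_pos_def_det_nonzero]

text \<open>Writing \<open>v\<close> as \<open>A\<close> applied to \<open>w\<close>, where
  \<open>w\<close> is the inverse applied to \<open>v\<close>, turns the form of the inverse at
  \<open>v\<close> into the conjugate of the form of \<open>A\<close> at \<open>w\<close>.\<close>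

lemma hermitian_pos_def_inverse:
  assumes "hermitian_pos_def d A"
  shows "hermitian_pos_def d (mat_inv A)"
proof -
  have A: "A \<in> carrier_mat d d" "mat_adjoint A = A" using assms by (auto simp: hermitian_pos_def_def)
  note B = hermitian_pos_def_inv[OF A(1) assms]
  let ?B = "mat_inv A"
  have AB: "A *\<^sub>v (?B *\<^sub>v v) = v" "?B *\<^sub>v (A *\<^sub>v v) = v" if "v \<in> carrier_vec d" for v
    using that A B by (simp_all flip: assoc_mult_mat_vec)
  have swap: "(?B *\<^sub>v v) \<bullet>c w = v \<bullet>c (?B *\<^sub>v w)" if "v \<in> carrier_vec d" "w \<in> carrier_vec d" for v w
  proof -
    have "(?B *\<^sub>v v) \<bullet>c w = (?B *\<^sub>v v) \<bullet>c (A *\<^sub>v (?B *\<^sub>v w))" using that by (simp add: AB)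
    also have "\<dots> = (A *\<^sub>v (?B *\<^sub>v v)) \<bullet>c (?B *\<^sub>v w)"
      using that A B by (subst cscalar_mat_adjoint[of A d d]) auto
    finally show ?thesis using that by (simp add: AB)
  qed
  have "mat_adjoint ?B = ?B"
    using B(1) swap by (rule mat_adjoint_eqI)
  moreover have "Re ((?B *\<^sub>v v) \<bullet>c v) > 0" if v: "v \<in> carrier_vec d" "v \<noteq> 0\<^sub>v d" for v
  proof -
    have c: "?B *\<^sub>v v \<in> carrier_vec d" using v B by auto
    have "?B *\<^sub>v v \<noteq> 0\<^sub>v d"
    proof
      assume "?B *\<^sub>v v = 0\<^sub>v d"
      then have "v = A *\<^sub>v 0\<^sub>v d" using AB(1)[OF v(1)] by simp
      with v(2) A show False by auto
    qed
    with c assms have "Re ((A *\<^sub>v (?B *\<^sub>v v)) \<bullet>c (?B *\<^sub>v v)) > 0"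
      by (auto simp: hermitian_pos_def_def)
    then show ?thesis using AB(1)[OF v(1)] cnj_cscalar[OF v(1) c] by (metis cnj.sel(1))
  qed
  ultimately show ?thesis using B(1) by (simp add: hermitian_pos_def_def)
qed

text \<open>A Schur triangularisation shows that the determinant is the product of the eigenvalues,
  and each of these is a positive real. This makes the normalising factor of the noise density
  positive, so that logarithms of densities split into sums.\<close>

lemma hermitian_pos_def_det_pos:
  assumes "hermitian_pos_def d A"
  shows "Re (Determinant.det A) > 0"
proof -
  have A: "A \<in> carrier_mat d d" "mat_adjoint A = A" using assms by (auto simp: hermitian_pos_def_def)
  obtain es where es: "char_poly A = (\<Prod>a \<leftarrow> es. [:- a, 1:])"
    using char_poly_factorized[OF A(1)] by auto
  obtain T P Q where "schur_decomposition A es = (T, P, Q)"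
    by (cases "schur_decomposition A es") auto
  from schur_decomposition[OF A(1) es this]
  have T: "similar_mat_wit A T P Q" "upper_triangular T" "diag_mat T = es" by auto
  have "T \<in> carrier_mat d d" using similar_mat_witD2[OF A(1) T(1)] by auto
  then have det: "Determinant.det A = prod_list es"
    using det_upper_triangular[OF T(2)] T(1,3) det_similar[of A T] by (auto simp: similar_mat_def)
  have "\<exists>r>0. e = complex_of_real r" if "e \<in> set es" for e
  proof -
    have "eigenvalue A e"
      using that es by (auto simp: eigenvalue_root_char_poly[OF A(1)] poly_prod_list prod_list_zero_iff)
    then obtain v where v: "v \<in> carrier_vec d" "v \<noteq> 0\<^sub>v d" "A *\<^sub>v v = e \<cdot>\<^sub>v v"
      using A(1) by (auto simp: eigenvalue_def eigenvector_def)
    have *: "(A *\<^sub>v v) \<bullet>c v = e * (v \<bullet>c v)" using v by simp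
    have "v \<bullet>c v > 0" using v by simp
    \<comment> \<open>Strict positivity in the order on the complex numbers includes a vanishing
      imaginary part.\<close>
    then obtain s where s: "v \<bullet>c v = complex_of_real s" "s > 0"
      by (metis complex_is_Real_iff less_complex_def of_real_Re zero_complex.sel of_real_def complex_eq_iff Re_complex_of_real Im_complex_of_real)
    \<comment> \<open>Definiteness gives the sign of the real part, Hermitian symmetry the vanishing
      of the imaginary part; dividing by the positive \<open>s\<close> transfers both to
      \<open>e\<close>.\<close>
    have "Re (e * s) > 0" using assms v * s(1) by (auto simp: hermitian_pos_def_def)
    moreover have "e * s = cnj (e * s)"
      using hermitian_cscalar_swap[OF A v(1) v(1)] * s(1) by simp
    ultimately have "Re e > 0" "Im e = 0"
      using s(2) by (auto simp: zero_less_mult_iff complex_eq_iff)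
    then show ?thesis by (intro exI[of _ "Re e"]) (auto simp: complex_eq_iff)
  qed
  then have "\<exists>r>0. prod_list es = complex_of_real r"
  proof (induction es)
    case Nil then show ?case by (intro exI[of _ 1]) auto
  next
    case (Cons a es)
    then obtain r s where "r > 0" "s > 0" "a = complex_of_real r" "prod_list es = complex_of_real s"
      by (metis list.set_intros)
    then show ?case by (intro exI[of _ "r * s"]) auto
  qed
  then show ?thesis using det by auto
qed

text \<open>The two mixed terms are conjugate to each other, so together they give twice a real
  part. The lemma serves both for translating the Gaussian density and, at \<open>t = -1\<close>,
  for expanding the residual.\<close>

lemma hermitian_form_add:
  fixes A :: "complex Matrix.mat" and t :: real
  assumes A: "A \<in> carrier_mat d d" "mat_adjoint A = A" and h: "h \<in> carrier_vec d" and v: "v \<in> carrier_vec d"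
  shows "Re ((A *\<^sub>v (h + complex_of_real t \<cdot>\<^sub>v v)) \<bullet>c (h + complex_of_real t \<cdot>\<^sub>v v)) =
    Re ((A *\<^sub>v h) \<bullet>c h) + 2 * t * Re ((A *\<^sub>v v) \<bullet>c h) + t\<^sup>2 * Re ((A *\<^sub>v v) \<bullet>c v)"
proof -
  let ?t = "complex_of_real t"
  have c: "A *\<^sub>v h \<in> carrier_vec d" "A *\<^sub>v v \<in> carrier_vec d" using A h v by auto
  have "A *\<^sub>v (h + ?t \<cdot>\<^sub>v v) = A *\<^sub>v h + ?t \<cdot>\<^sub>v (A *\<^sub>v v)"
    using A h v by (simp add: mult_add_distrib_mat_vec mult_mat_vec)
  moreover have "conjugate (h + ?t \<cdot>\<^sub>v v) = conjugate h + ?t \<cdot>\<^sub>v conjugate v"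
    using h v by (simp add: conjugate_add_vec[of _ d] conjugate_smult_vec)
  ultimately have "(A *\<^sub>v (h + ?t \<cdot>\<^sub>v v)) \<bullet>c (h + ?t \<cdot>\<^sub>v v) =
      (A *\<^sub>v h) \<bullet>c h + ?t * ((A *\<^sub>v h) \<bullet>c v) + ?t * ((A *\<^sub>v v) \<bullet>c h) + ?t\<^sup>2 * ((A *\<^sub>v v) \<bullet>c v)"
    using c h v
    by (simp add: add_scalar_prod_distrib[of _ d] scalar_prod_add_distrib[of _ d] power2_eq_square algebra_simps)
  also have "(A *\<^sub>v h) \<bullet>c v = cnj ((A *\<^sub>v v) \<bullet>c h)"
    by (rule hermitian_cscalar_swap[OF A h v])
  finally show ?thesis by (simp add: power2_eq_square)
qed

text \<open>Expand the form at a difference and move \<open>X\<close> across the scalar product as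
  its adjoint. This exhibits the likelihood exponent as a quadratic polynomial in the channel column
  \<open>h\<close>.\<close>

lemma hermitian_form_residual:
  fixes B X :: "complex Matrix.mat"
  assumes B: "B \<in> carrier_mat p p" "mat_adjoint B = B" and X: "X \<in> carrier_mat p d"
    and y: "y \<in> carrier_vec p" and h: "h \<in> carrier_vec d"
  shows "Re ((B *\<^sub>v (y - X *\<^sub>v h)) \<bullet>c (y - X *\<^sub>v h)) =
    Re ((B *\<^sub>v y) \<bullet>c y) - 2 * Re ((mat_adjoint X *\<^sub>v (B *\<^sub>v y)) \<bullet>c h) +
    Re (((mat_adjoint X * B * X) *\<^sub>v h) \<bullet>c h)"
proof -
  note X' = mat_adjoint_carrier[OF X]
  have Xh: "X *\<^sub>v h \<in> carrier_vec p" using X h by simp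
  have "y - X *\<^sub>v h = y + complex_of_real (- 1) \<cdot>\<^sub>v (X *\<^sub>v h)"
    using y Xh by (intro eq_vecI) auto
  moreover have "(mat_adjoint X *\<^sub>v (B *\<^sub>v y)) \<bullet>c h = cnj ((B *\<^sub>v (X *\<^sub>v h)) \<bullet>c y)"
    using cscalar_mat_adjoint'[OF X _ h, of "B *\<^sub>v y"] hermitian_cscalar_swap[OF B y Xh] B y by simp
  moreover have "(mat_adjoint X * B * X) *\<^sub>v h = mat_adjoint X *\<^sub>v (B *\<^sub>v (X *\<^sub>v h))"
    using X X' B h by (simp add: assoc_mult_mat_vec[of _ d p _ d] assoc_mult_mat_vec[of _ p p _ d])
  moreover have "(mat_adjoint X *\<^sub>v (B *\<^sub>v (X *\<^sub>v h))) \<bullet>c h = (B *\<^sub>v (X *\<^sub>v h)) \<bullet>c (X *\<^sub>v h)"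
    using B Xh by (intro cscalar_mat_adjoint'[OF X _ h]) auto
  ultimately show ?thesis
    using hermitian_form_add[OF B y Xh, of "- 1"] by simp
qed

lemma mat_diag_form:
  fixes a :: "nat \<Rightarrow> real"
  assumes "h \<in> carrier_vec d"
  shows "(mat_diag d (\<lambda>j. complex_of_real (a j)) *\<^sub>v h) \<bullet>c h = complex_of_real (\<Sum>j<d. a j * (cmod (h $ j))\<^sup>2)"
proof -
  have "(mat_diag d (\<lambda>j. complex_of_real (a j)) *\<^sub>v h) $ j = complex_of_real (a j) * h $ j" if "j < d" for j
  proof -
    have "(mat_diag d (\<lambda>j. complex_of_real (a j)) *\<^sub>v h) $ j =
        (\<Sum>i = 0..<d. (if j = i then complex_of_real (a i) else 0) * h $ i)"
      using that assms by (auto simp: mat_diag_def scalar_prod_def)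
    also have "\<dots> = (\<Sum>i = 0..<d. if j = i then complex_of_real (a i) * h $ i else 0)"
      by (intro sum.cong) auto
    finally show ?thesis using that by simp
  qed
  moreover have "dim_vec (mat_diag d (\<lambda>j. complex_of_real (a j)) *\<^sub>v h) = d" by (simp add: mat_diag_def)
  ultimately show ?thesis
    using assms unfolding scalar_prod_def
    by (auto simp: atLeast0LessThan complex_norm_square mult.assoc simp del: index_mult_mat_vec of_real_power intro!: sum.cong)
qed

text \<open>The first summand contributes the form of \<open>B\<close> at the image of
  \<open>v\<close> under \<open>X\<close>, which is nonnegative but may vanish if \<open>X\<close>
  has a kernel. The positive diagonal supplies strictness. Applied to the model, this makes the
  posterior precision invertible.\<close>

lemma hermitian_pos_def_gram_add_diag:
  fixes B X :: "complex Matrix.mat" and a :: "nat \<Rightarrow> real"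
  assumes B: "hermitian_pos_def p B" and X: "X \<in> carrier_mat p d" and a: "\<And>j. j < d \<Longrightarrow> a j > 0"
  shows "hermitian_pos_def d (mat_adjoint X * B * X + mat_diag d (\<lambda>j. complex_of_real (a j)))"
proof -
  let ?D = "mat_diag d (\<lambda>j. complex_of_real (a j))"
  let ?A = "mat_adjoint X * B * X + ?D"
  note X' = mat_adjoint_carrier[OF X]
  have Bc: "B \<in> carrier_mat p p" "mat_adjoint B = B" using B by (auto simp: hermitian_pos_def_def)
  have "mat_adjoint ?D = ?D"
  proof (rule eq_matI)
    fix i j assume "i < dim_row ?D" "j < dim_col ?D"
    then have ij: "i < d" "j < d" by (auto simp: mat_diag_def)
    have "mat_adjoint ?D $$ (i, j) = conjugate (?D $$ (j, i))"
      using ij by (intro mat_adjoint_index) (auto simp: mat_diag_def)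
    then show "mat_adjoint ?D $$ (i, j) = ?D $$ (i, j)" using ij by (simp add: mat_diag_def)
  qed (auto simp: mat_diag_def mat_adjoint_def)
  then have D: "?D \<in> carrier_mat d d" "mat_adjoint ?D = ?D" by simp_all
  have A: "?A \<in> carrier_mat d d" using X X' Bc D by auto
  \<comment> \<open>Symmetry and positivity are both read off from this splitting of the
    form.\<close>
  have split: "(?A *\<^sub>v v) \<bullet>c w = (B *\<^sub>v (X *\<^sub>v v)) \<bullet>c (X *\<^sub>v w) + (?D *\<^sub>v v) \<bullet>c w"
    if "v \<in> carrier_vec d" "w \<in> carrier_vec d" for v w
  proof -
    have "?A *\<^sub>v v = mat_adjoint X *\<^sub>v (B *\<^sub>v (X *\<^sub>v v)) + ?D *\<^sub>v v"
      using that X X' Bc D by (simp add: add_mult_distrib_mat_vec[of _ d d] assoc_mult_mat_vec[of _ d p _ d] assoc_mult_mat_vec[of _ p p _ d])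
    moreover have "mat_adjoint X *\<^sub>v (B *\<^sub>v (X *\<^sub>v v)) \<in> carrier_vec d" "?D *\<^sub>v v \<in> carrier_vec d"
      "B *\<^sub>v (X *\<^sub>v v) \<in> carrier_vec p" "conjugate w \<in> carrier_vec d"
      using that X X' Bc D by (auto intro!: mult_mat_vec_carrier)
    ultimately show ?thesis
      using that by (simp only: add_scalar_prod_distrib cscalar_mat_adjoint'[OF X])
  qed
  have "mat_adjoint ?A = ?A"
  proof (rule mat_adjoint_eqI[OF A])
    fix v w :: "complex Matrix.vec" assume vw: "v \<in> carrier_vec d" "w \<in> carrier_vec d"
    have "(?A *\<^sub>v v) \<bullet>c w = cnj ((?A *\<^sub>v w) \<bullet>c v)"
      using hermitian_cscalar_swap[OF Bc, of "X *\<^sub>v v" "X *\<^sub>v w"] hermitian_cscalar_swap[OF D vw] X vw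
      unfolding split[OF vw] split[OF vw(2,1)] by simp
    then show "(?A *\<^sub>v v) \<bullet>c w = v \<bullet>c (?A *\<^sub>v w)"
      using cnj_cscalar[of "?A *\<^sub>v w" d v] A vw by simp
  qed
  moreover have "Re ((?A *\<^sub>v v) \<bullet>c v) > 0" if v: "v \<in> carrier_vec d" "v \<noteq> 0\<^sub>v d" for v
  proof -
    have "Re ((B *\<^sub>v (X *\<^sub>v v)) \<bullet>c (X *\<^sub>v v)) \<ge> 0"
      using B X v by (cases "X *\<^sub>v v = 0\<^sub>v p") (auto simp: hermitian_pos_def_def less_imp_le)
    moreover obtain j where j: "j < d" "v $ j \<noteq> 0"
      using v by (metis carrier_vecD eq_vecI index_zero_vec)
    have "(\<Sum>j<d. a j * (cmod (v $ j))\<^sup>2) > 0"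
      using a j by (intro sum_pos2[of _ j]) (auto simp: less_imp_le)
    ultimately show ?thesis using split[OF v(1) v(1)] mat_diag_form[OF v(1), of a] by simp
  qed
  ultimately show ?thesis using A by (simp add: hermitian_pos_def_def)
qed

section \<open>Lebesgue measure on complex matrices\<close>

abbreviation (input) lborel_coords :: "nat \<Rightarrow> nat \<Rightarrow> (nat \<times> nat \<Rightarrow> complex) measure" where
  "lborel_coords r c \<equiv> Pi\<^sub>M ({0..<r} \<times> {0..<c}) (\<lambda>_. lborel)"

lemma product_sigma_finite_lborel: "product_sigma_finite (\<lambda>_. lborel :: 'a::euclidean_space measure)"
  by standard

text \<open>Functions in the product space are extensional, so the matrix entries determine them
  completely. The transfer rules for \<open>embed_measure\<close> rest on this injectivity.\<close>

lemma inj_on_mat_coords: "inj_on (Matrix.mat r c) (space (lborel_coords r c))"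
proof (rule inj_onI)
  fix f g assume f: "f \<in> space (lborel_coords r c)" and g: "g \<in> space (lborel_coords r c)"
    and eq: "Matrix.mat r c f = Matrix.mat r c g"
  have "f p = g p" if "p \<in> {0..<r} \<times> {0..<c}" for p
    using that arg_cong[OF eq, of "\<lambda>A. A $$ p"] by auto
  with f g show "f = g" by (intro PiE_ext[of f _ "\<lambda>_. UNIV" g]) (auto simp: space_PiM)
qed

lemma space_lborel_mat: "space (lborel_mat r c) = carrier_mat r c"
proof -
  have "A \<in> Matrix.mat r c ` space (lborel_coords r c)" if "A \<in> carrier_mat r c" for A
    using that
    by (intro image_eqI[of _ _ "restrict (\<lambda>p. A $$ p) ({0..<r} \<times> {0..<c})"]) (auto simp: space_PiM)
  then show ?thesis by (auto simp: lborel_mat_def space_embed_measure)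
qed

lemma measurable_lborel_mat_index [measurable]:
  assumes "j < r" "k < c"
  shows "(\<lambda>H. H $$ (j, k)) \<in> borel_measurable (lborel_mat r c)"
  unfolding lborel_mat_def
proof (rule measurable_embed_measure1)
  have "(\<lambda>f. f (j, k)) \<in> measurable (lborel_coords r c) lborel"
    using assms by (intro measurable_component_singleton) auto
  then show "(\<lambda>f. Matrix.mat r c f $$ (j, k)) \<in> borel_measurable (lborel_coords r c)"
    using assms by simp
qed

lemma nn_integral_lborel_mat:
  assumes "g \<in> borel_measurable (lborel_mat r c)"
  shows "(\<integral>\<^sup>+H. g H \<partial>lborel_mat r c) = (\<integral>\<^sup>+f. g (Matrix.mat r c f) \<partial>lborel_coords r c)"
  using nn_integral_embed_measure'[OF inj_on_mat_coords] assms unfolding lborel_mat_def by blast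

lemma measurable_mat_coords:
  "Matrix.mat r c \<in> measurable (lborel_coords r c) (lborel_mat r c)"
  unfolding lborel_mat_def by (rule measurable_embed_measure2'[OF inj_on_mat_coords])

text \<open>A product measure is determined by its values on boxes. The preimage of a box under
  translation is a box with translated sides, and Lebesgue measure on each factor is translation
  invariant.\<close>

lemma distr_PiM_lborel_translate:
  fixes a :: "'i \<Rightarrow> 'a::euclidean_space"
  assumes "finite I"
  shows "distr (Pi\<^sub>M I (\<lambda>_. lborel)) (Pi\<^sub>M I (\<lambda>_. lborel)) (\<lambda>f. \<lambda>i\<in>I. a i + f i) = Pi\<^sub>M I (\<lambda>_. lborel)"
    (is "distr ?M _ ?T = _")
proof -
  interpret product_sigma_finite "\<lambda>_::'i. lborel :: 'a measure" by (rule product_sigma_finite_lborel)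
  have T: "?T \<in> measurable ?M ?M" by measurable
  show ?thesis
  proof (rule PiM_eqI)
    fix A :: "'i \<Rightarrow> 'a set" assume A: "\<And>i. i \<in> I \<Longrightarrow> A i \<in> sets lborel"
    then have B: "(\<lambda>x. a i + x) -` A i \<in> sets lborel" if "i \<in> I" for i
      using that measurable_sets[of "\<lambda>x. a i + x" borel borel "A i"] by simp
    have "emeasure (distr ?M ?M ?T) (Pi\<^sub>E I A) = emeasure ?M (?T -` Pi\<^sub>E I A \<inter> space ?M)"
      using assms A T by (intro emeasure_distr sets_PiM_I_finite) auto
    also have "?T -` Pi\<^sub>E I A \<inter> space ?M = Pi\<^sub>E I (\<lambda>i. (\<lambda>x. a i + x) -` A i)"
      by (auto simp: space_PiM PiE_iff)
    also have "emeasure ?M \<dots> = (\<Prod>i\<in>I. emeasure lborel ((\<lambda>x. a i + x) -` A i))"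
      using assms B by (intro emeasure_PiM) auto
    also have "\<dots> = (\<Prod>i\<in>I. emeasure lborel (A i))"
    proof (intro prod.cong refl)
      fix i assume "i \<in> I"
      have "emeasure lborel (A i) = emeasure (distr lborel borel ((+) (a i))) (A i)"
        by (simp add: lborel_distr_plus)
      also have "\<dots> = emeasure lborel ((\<lambda>x. a i + x) -` A i)"
        using A[OF \<open>i \<in> I\<close>] by (subst emeasure_distr) auto
      finally show "emeasure lborel ((\<lambda>x. a i + x) -` A i) = emeasure lborel (A i)" ..
    qed
    finally show "emeasure (distr ?M ?M ?T) (Pi\<^sub>E I A) = (\<Prod>i\<in>I. emeasure lborel (A i))" .
  qed (use assms in auto)
qed

text \<open>In coordinates, adding \<open>V\<close> is the translation of the product space treated
  above. Measurability of the shifted integrand is a premise, which the application discharges from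
  an explicit formula for that integrand.\<close>

lemma nn_integral_lborel_mat_translate:
  assumes g: "g \<in> borel_measurable (lborel_mat r c)" and V: "V \<in> carrier_mat r c"
    and gV: "(\<lambda>H. g (H + V)) \<in> borel_measurable (lborel_mat r c)"
  shows "(\<integral>\<^sup>+H. g (H + V) \<partial>lborel_mat r c) = (\<integral>\<^sup>+H. g H \<partial>lborel_mat r c)"
proof -
  let ?I = "{0..<r} \<times> {0..<c}"
  let ?T = "\<lambda>f. \<lambda>i\<in>?I. V $$ i + f i"
  have T: "?T \<in> measurable (lborel_coords r c) (lborel_coords r c)" by measurable
  have "(\<integral>\<^sup>+H. g (H + V) \<partial>lborel_mat r c) = (\<integral>\<^sup>+f. g (Matrix.mat r c f + V) \<partial>lborel_coords r c)"
    by (rule nn_integral_lborel_mat[OF gV])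
  also have "\<dots> = (\<integral>\<^sup>+f. g (Matrix.mat r c (?T f)) \<partial>lborel_coords r c)"
  proof (rule nn_integral_cong)
    fix f
    have "Matrix.mat r c f + V = Matrix.mat r c (?T f)" using V by (intro eq_matI) auto
    then show "g (Matrix.mat r c f + V) = g (Matrix.mat r c (?T f))" by simp
  qed
  also have "\<dots> = (\<integral>\<^sup>+f. g (Matrix.mat r c f) \<partial>distr (lborel_coords r c) (lborel_coords r c) ?T)"
    by (rule nn_integral_distr[symmetric, OF T])
      (use measurable_compose[OF measurable_mat_coords g] in simp)
  also have "\<dots> = (\<integral>\<^sup>+H. g H \<partial>lborel_mat r c)"
    by (simp add: distr_PiM_lborel_translate nn_integral_lborel_mat[OF g])
  finally show ?thesis .
qed

lemma nn_integral_lborel_mat_prod: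
  assumes "\<And>p. p \<in> {0..<r} \<times> {0..<c} \<Longrightarrow> f p \<in> borel_measurable borel"
  shows "(\<integral>\<^sup>+H. (\<Prod>p\<in>{0..<r} \<times> {0..<c}. f p (H $$ p)) \<partial>lborel_mat r c) =
    (\<Prod>p\<in>{0..<r} \<times> {0..<c}. \<integral>\<^sup>+z. f p z \<partial>lborel)"
proof -
  interpret product_sigma_finite "\<lambda>_::nat \<times> nat. lborel :: complex measure"
    by (rule product_sigma_finite_lborel)
  have "(\<lambda>H. \<Prod>p\<in>{0..<r} \<times> {0..<c}. f p (H $$ p)) \<in> borel_measurable (lborel_mat r c)"
    by (intro borel_measurable_prod_ennreal measurable_compose[OF _ assms]) (auto simp: measurable_lborel_mat_index)
  then show ?thesis
    using assms
    by (simp add: nn_integral_lborel_mat product_nn_integral_prod[symmetric])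
      (auto intro!: nn_integral_cong prod.cong)
qed

text \<open>The integrand factors into the real and the imaginary coordinate, and each factor is a
  multiple of a normal density.\<close>

lemma nn_integral_complex_gaussian_finite:
  assumes "a > 0"
  shows "(\<integral>\<^sup>+z. ennreal (exp (- (cmod z)\<^sup>2 / a)) \<partial>lborel) < \<infinity>"
proof -
  have fin: "(\<integral>\<^sup>+x. ennreal (exp (- x\<^sup>2 / a)) \<partial>lborel) < \<infinity>"
  proof -
    \<comment> \<open>The variance \<open>a / 2\<close> is the one for which the exponent of the
      normal density is minus the square of \<open>x\<close> divided by \<open>a\<close>.\<close>
    define \<sigma> where "\<sigma> = sqrt (a / 2)"
    have \<sigma>: "\<sigma> > 0" "2 * \<sigma>\<^sup>2 = a" using assms by (auto simp: \<sigma>_def)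
    have "integrable lborel (\<lambda>x. sqrt (2 * pi * \<sigma>\<^sup>2) * normal_density 0 \<sigma> x)"
      using \<sigma> by (intro integrable_mult_right integrable_normal_density) auto
    also have "(\<lambda>x. sqrt (2 * pi * \<sigma>\<^sup>2) * normal_density 0 \<sigma> x) = (\<lambda>x. exp (- x\<^sup>2 / a))"
      using \<sigma> by (auto simp: normal_density_def)
    finally show ?thesis by (simp add: integrable_iff_bounded)
  qed
  have "(\<integral>\<^sup>+z. ennreal (exp (- (cmod z)\<^sup>2 / a)) \<partial>lborel) =
      (\<integral>\<^sup>+z. (\<Prod>b\<in>Basis. ennreal (exp (- (z \<bullet> b)\<^sup>2 / a))) \<partial>(lborel :: complex measure))"
    by (intro nn_integral_cong)
      (auto simp: Basis_complex_def cmod_power2 inner_complex_def diff_divide_distrib simp flip: ennreal_mult exp_add)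
  also have "\<dots> = (\<Prod>b\<in>(Basis :: complex set). \<integral>\<^sup>+x. ennreal (exp (- x\<^sup>2 / a)) \<partial>lborel)"
    by (rule nn_integral_lborel_prod) auto
  also have "\<dots> < \<infinity>"
    using fin by (simp add: power_less_top_ennreal)
  finally show ?thesis .
qed

text \<open>The total mass is a product of nonzero factors, and the empty product is 1. It is needed
  to see that a positive density has nonzero integral.\<close>

lemma emeasure_lborel_mat_space_nonzero: "emeasure (lborel_mat r c) (space (lborel_mat r c)) \<noteq> 0"
proof -
  have "emeasure (lborel_mat r c) (space (lborel_mat r c)) =
      (\<integral>\<^sup>+H. (\<Prod>p\<in>{0..<r} \<times> {0..<c}. 1) \<partial>lborel_mat r c)" by simp
  also have "\<dots> = (\<Prod>p\<in>{0..<r} \<times> {0..<c}. \<integral>\<^sup>+z. 1 \<partial>(lborel :: complex measure))"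
    by (rule nn_integral_lborel_mat_prod) auto
  also have "\<dots> \<noteq> 0" by simp
  finally show ?thesis .
qed

section \<open>Second moments of Gaussian densities\<close>

text \<open>On nonnegative arguments \<open>sinh\<close> is superadditive, by its addition formula
  and \<open>cosh\<close> being at least 1. The inequality supplies the dominating function in the
  next lemma.\<close>

lemma real_mult_sinh_le:
  fixes u :: real
  assumes "u \<ge> 0"
  shows "real n * sinh u \<le> sinh (real n * u)"
proof (induction n)
  case (Suc n)
  have "sinh (real n * u) * 1 \<le> sinh (real n * u) * cosh u" "1 * sinh u \<le> cosh (real n * u) * sinh u"
    using assms by (intro mult_left_mono mult_right_mono cosh_real_ge_1; simp)+
  moreover have "real (Suc n) * u = real n * u + u" "real (Suc n) * sinh u = real n * sinh u + sinh u"
    by (simp_all add: algebra_simps)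
  ultimately show ?case using Suc by (simp only: sinh_add)
qed simp

text \<open>The moment generating function is that of a real Gaussian with mean \<open>m\<close> and
  variance \<open>s / 2\<close>. Instead of differentiating it under the integral, the square is
  approximated by second difference quotients of \<open>exp\<close> at 0, whose expectations are
  known exactly, and dominated convergence gives both integrability and the value.\<close>

lemma has_second_moment_of_mgf:
  fixes X :: "'a \<Rightarrow> real"
  assumes "prob_space P" and X [measurable]: "X \<in> borel_measurable P"
    and mgf: "\<And>t. (\<integral>\<^sup>+w. ennreal (exp (t * X w)) \<partial>P) = ennreal (exp (t\<^sup>2 * s / 4 + t * m))"
  shows "integrable P (\<lambda>w. (X w)\<^sup>2)" "(\<integral>w. (X w)\<^sup>2 \<partial>P) = s / 2 + m\<^sup>2"
proof -
  interpret prob_space P by fact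
  have int: "integrable P (\<lambda>w. exp (t * X w))" for t
    by (rule integrableI_nn_integral_finite[where x = "exp (t\<^sup>2 * s / 4 + t * m)"]) (auto simp: mgf)
  have val: "(\<integral>w. exp (t * X w) \<partial>P) = exp (t\<^sup>2 * s / 4 + t * m)" for t
    by (subst integral_eq_nn_integral) (auto simp: mgf)
  have intc: "integrable P (\<lambda>w. cosh (t * X w) - 1)" for t
    using int[of t] int[of "-t"] by (auto simp: cosh_def)
  have valc: "(\<integral>w. cosh (t * X w) - 1 \<partial>P) = exp (t\<^sup>2 * s / 4) * cosh (t * m) - 1" for t
  proof -
    have "(\<integral>w. cosh (t * X w) - 1 \<partial>P) =
        ((\<integral>w. exp (t * X w) \<partial>P) + (\<integral>w. exp (- t * X w) \<partial>P)) / 2 - 1"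
      using int[of t] int[of "-t"] by (simp add: cosh_def prob_space)
    moreover have "exp (t\<^sup>2 * s / 4 + t * m) + exp ((- t)\<^sup>2 * s / 4 + - t * m) =
        2 * (exp (t\<^sup>2 * s / 4) * cosh (t * m))"
      by (simp only: cosh_def exp_add) (simp add: scaleR_conv_of_real distrib_left)
    ultimately show ?thesis unfolding val by simp
  qed
  \<comment> \<open>This is the symmetric second difference quotient of \<open>t\<close> mapped to
    \<open>exp (t * x)\<close> at 0 with step \<open>1 / Suc n\<close>; the successor keeps the step
    well defined.\<close>
  define F where "F n x = 2 * (real (Suc n))\<^sup>2 * (cosh (x / real (Suc n)) - 1)" for n x
  have lim: "(\<lambda>n. F n x) \<longlonglongrightarrow> x\<^sup>2" for x
  proof (cases "x = 0")
    case False
    then have "(\<lambda>n. 2 * (real (Suc n))\<^sup>2 * (cosh (1 / real (Suc n) * x) - 1)) \<longlonglongrightarrow> x\<^sup>2"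
      unfolding cosh_field_def by (real_asymp simp: power2_eq_square)
    then show ?thesis by (simp add: F_def)
  qed (simp add: F_def)
  \<comment> \<open>By the half-angle formula \<open>cosh y - 1\<close> is twice the square of
    \<open>sinh\<close> at \<open>y / 2\<close>, so the bound reduces to the inequality between
    \<open>N * sinh (u / N)\<close> and \<open>sinh u\<close>.\<close>
  have bound: "norm (F n x) \<le> 2 * (cosh x - 1)" for n x
  proof -
    let ?N = "real (Suc n)"
    have cosh: "cosh y - 1 = 2 * (sinh \<bar>y / 2\<bar>)\<^sup>2" for y :: real
      using cosh_double[of "y / 2"] cosh_square_eq[of "y / 2"]
      by (simp only: sinh_real_abs power2_abs) simp
    have "?N * sinh (\<bar>x / 2\<bar> / ?N) \<le> sinh \<bar>x / 2\<bar>"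
      using real_mult_sinh_le[of "\<bar>x / 2\<bar> / ?N" "Suc n"] by (simp only: nonzero_mult_div_cancel_left times_divide_eq_right) simp
    then have "(?N * sinh (\<bar>x / 2\<bar> / ?N))\<^sup>2 \<le> (sinh \<bar>x / 2\<bar>)\<^sup>2"
      by (intro power_mono) auto
    moreover have "\<bar>x / ?N / 2\<bar> = \<bar>x / 2\<bar> / ?N" by simp
    ultimately show ?thesis
      unfolding F_def cosh by (simp only: power_mult_distrib) simp
  qed
  have 1: "(\<lambda>w. F n (X w)) \<in> borel_measurable P" for n by (auto simp: F_def cosh_def)
  have dom: "integrable P (\<lambda>w. 2 * (cosh (X w) - 1))"
    by (intro integrable_mult_right) (use intc[of 1] in simp)
  show "integrable P (\<lambda>w. (X w)\<^sup>2)"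
    by (rule integrable_dominated_convergence[where s = "\<lambda>n w. F n (X w)", OF _ 1 dom]) (use lim bound in auto)
  have "(\<lambda>n. \<integral>w. F n (X w) \<partial>P) \<longlonglongrightarrow> (\<integral>w. (X w)\<^sup>2 \<partial>P)"
    by (rule integral_dominated_convergence[where s = "\<lambda>n w. F n (X w)", OF _ 1 dom]) (use lim bound in auto)
  moreover have "(\<lambda>n. \<integral>w. F n (X w) \<partial>P) \<longlonglongrightarrow> s / 2 + m\<^sup>2"
  proof -
    have "(\<integral>w. F n (X w) \<partial>P) = 2 * (real (Suc n))\<^sup>2 * (exp ((1 / real (Suc n))\<^sup>2 * s / 4) * cosh (1 / real (Suc n) * m) - 1)" for n
      using valc[of "1 / real (Suc n)"] by (simp add: F_def)
    \<comment> \<open>Expanding \<open>exp\<close> and \<open>cosh\<close> at 0, the bracket is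
      \<open>(s / 4 + m^2 / 2) / (n + 1)^2\<close> up to higher order.\<close>
    moreover have "(\<lambda>n. 2 * (real (Suc n))\<^sup>2 * (exp ((1 / real (Suc n))\<^sup>2 * s / 4) * cosh (1 / real (Suc n) * m) - 1)) \<longlonglongrightarrow> s / 2 + m\<^sup>2"
      unfolding cosh_field_def by (real_asymp simp: power2_eq_square)
    ultimately show ?thesis by simp
  qed
  ultimately show "(\<integral>w. (X w)\<^sup>2 \<partial>P) = s / 2 + m\<^sup>2" by (rule LIMSEQ_unique)
qed

section \<open>Unnormalised Gaussian densities on matrices: mass, generating function, second
  moments\<close>

lemma measurable_cnj: "g \<in> borel_measurable M \<Longrightarrow> (\<lambda>x. cnj (g x)) \<in> borel_measurable M"
  by (intro borel_measurable_continuous_on[of cnj] continuous_intros)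

text \<open>All columns share the precision matrix \<open>A\<close>, and column \<open>k\<close> has
  its own linear term \<open>b k\<close>; completing the square would give the mean
  \<open>mat_inv A\<close> applied to \<open>b k\<close>. The constant \<open>C\<close> is left
  open, and finiteness of the mass is an assumption that the model establishes by bounding the
  likelihood.\<close>

locale matrix_gaussian =
  fixes d K :: nat and f :: "complex Matrix.mat \<Rightarrow> real"
    and A :: "complex Matrix.mat" and b :: "nat \<Rightarrow> complex Matrix.vec" and C :: real
  assumes A: "hermitian_pos_def d A"
    and b: "\<And>k. k < K \<Longrightarrow> b k \<in> carrier_vec d"
    and C: "C > 0"
    and f: "\<And>H. H \<in> carrier_mat d K \<Longrightarrow>
      f H = C * exp (- (\<Sum>k<K. Re ((A *\<^sub>v col H k) \<bullet>c col H k) - 2 * Re (b k \<bullet>c col H k)))"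
    and finite_mass: "(\<integral>\<^sup>+H. ennreal (f H) \<partial>lborel_mat d K) < \<infinity>"
begin

abbreviation "Z \<equiv> \<integral>\<^sup>+H. ennreal (f H) \<partial>lborel_mat d K"
abbreviation "P \<equiv> density (lborel_mat d K) (\<lambda>H. ennreal (f H) / Z)"

lemma A_carrier: "A \<in> carrier_mat d d" and A_adjoint: "mat_adjoint A = A"
  using A by (auto simp: hermitian_pos_def_def)

lemma f_pos: "H \<in> carrier_mat d K \<Longrightarrow> f H > 0"
  using C by (simp add: f)

lemma measurable_cscalar_col:
  assumes "v \<in> carrier_vec d" "k < K"
  shows "(\<lambda>H. Re (v \<bullet>c col H k)) \<in> borel_measurable (lborel_mat d K)"
proof -
  have "(\<lambda>H. Re (\<Sum>j = 0..<d. v $ j * cnj (H $$ (j, k)))) \<in> borel_measurable (lborel_mat d K)"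
    using assms by (intro measurable_compose[OF _ borel_measurable_Re] borel_measurable_sum borel_measurable_times
      measurable_cnj measurable_lborel_mat_index) auto
  then show ?thesis
    using assms by (subst measurable_cong) (auto simp: space_lborel_mat scalar_prod_def)
qed

lemma measurable_form_col:
  assumes "k < K"
  shows "(\<lambda>H. Re ((A *\<^sub>v col H k) \<bullet>c col H k)) \<in> borel_measurable (lborel_mat d K)"
proof -
  have "(\<lambda>H. Re (\<Sum>i = 0..<d. (\<Sum>j = 0..<d. A $$ (i, j) * H $$ (j, k)) * cnj (H $$ (i, k))))
      \<in> borel_measurable (lborel_mat d K)"
    using assms by (intro measurable_compose[OF _ borel_measurable_Re] borel_measurable_sum borel_measurable_times
      borel_measurable_const measurable_cnj measurable_lborel_mat_index) auto
  then show ?thesis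
    using assms A_carrier by (subst measurable_cong) (auto simp: space_lborel_mat scalar_prod_def)
qed

lemma measurable_f: "f \<in> borel_measurable (lborel_mat d K)"
proof -
  have "(\<lambda>H. C * exp (- (\<Sum>k<K. Re ((A *\<^sub>v col H k) \<bullet>c col H k) - 2 * Re (b k \<bullet>c col H k))))
      \<in> borel_measurable (lborel_mat d K)"
    using b by (intro borel_measurable_times borel_measurable_const measurable_compose[OF _ borel_measurable_exp]
      borel_measurable_uminus borel_measurable_sum borel_measurable_diff measurable_form_col measurable_cscalar_col) auto
  then show ?thesis
    by (subst measurable_cong) (auto simp: space_lborel_mat f)
qed

text \<open>A vanishing integral would force the density to be 0 almost everywhere, but it is
  positive everywhere on a space that is not a null set.\<close>

lemma mass_nonzero: "Z \<noteq> 0"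
proof
  note [measurable] = measurable_f
  assume "Z = 0"
  then have "AE H in lborel_mat d K. ennreal (f H) = 0" by (subst (asm) nn_integral_0_iff_AE) auto
  moreover have "AE H in lborel_mat d K. ennreal (f H) \<noteq> 0"
    by (rule AE_I2) (use f_pos in \<open>auto simp: space_lborel_mat ennreal_eq_0_iff not_le\<close>)
  ultimately have "AE H in lborel_mat d K. False" by eventually_elim auto
  then show False
    using emeasure_lborel_mat_space_nonzero[of d K] by (simp add: AE_iff_measurable[OF sets.top])
qed

lemma nn_integral_P:
  assumes "g \<in> borel_measurable (lborel_mat d K)"
  shows "(\<integral>\<^sup>+H. g H \<partial>P) = (\<integral>\<^sup>+H. ennreal (f H) * g H \<partial>lborel_mat d K) / Z"
proof -
  note [measurable] = measurable_f assms
  have "(\<integral>\<^sup>+H. g H \<partial>P) = (\<integral>\<^sup>+H. ennreal (f H) / Z * g H \<partial>lborel_mat d K)"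
    by (rule nn_integral_density) auto
  also have "\<dots> = (\<integral>\<^sup>+H. ennreal (f H) * g H / Z \<partial>lborel_mat d K)"
    by (simp add: divide_ennreal_def mult_ac)
  also have "\<dots> = (\<integral>\<^sup>+H. ennreal (f H) * g H \<partial>lborel_mat d K) / Z"
    by (rule nn_integral_divide) auto
  finally show ?thesis .
qed

lemma prob_space_P: "prob_space P"
proof
  have "emeasure P (space P) = (\<integral>\<^sup>+H. 1 \<partial>P)" by simp
  also have "\<dots> = Z / Z" by (subst nn_integral_P) auto
  also have "\<dots> = 1" using mass_nonzero finite_mass by (intro ennreal_divide_self) auto
  finally show "emeasure P (space P) = 1" .
qed

text \<open>The exponent is a sum over columns and only column \<open>k\<close> moves. Its quadratic
  part then produces a constant and a term linear in that column, so the density is multiplied by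
  the exponential of an affine functional.\<close>

lemma f_translate:
  fixes t :: real
  assumes H: "H \<in> carrier_mat d K" and v: "v \<in> carrier_vec d" and k: "k < K"
  defines "V \<equiv> Matrix.mat d K (\<lambda>(i, l). if l = k then complex_of_real t * v $ i else 0)"
  shows "f (H + V) = f H * exp (- (2 * t * Re ((A *\<^sub>v v) \<bullet>c col H k) +
    t\<^sup>2 * Re ((A *\<^sub>v v) \<bullet>c v) - 2 * t * Re (b k \<bullet>c v)))"
proof -
  define q where "q l h = Re ((A *\<^sub>v h) \<bullet>c h) - 2 * Re (b l \<bullet>c h)" for l h
  define \<Delta> where "\<Delta> = 2 * t * Re ((A *\<^sub>v v) \<bullet>c col H k) + t\<^sup>2 * Re ((A *\<^sub>v v) \<bullet>c v) - 2 * t * Re (b k \<bullet>c v)"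
  have V: "V \<in> carrier_mat d K" by (simp add: V_def)
  have "q l (col (H + V) l) = q l (col H l) + (if l = k then \<Delta> else 0)" if l: "l < K" for l
  proof (cases "l = k")
    case True
    have col: "col (H + V) k = col H k + complex_of_real t \<cdot>\<^sub>v v"
      using H v k by (intro eq_vecI) (auto simp: V_def)
    have h: "col H k \<in> carrier_vec d" using H by auto
    have "conjugate (col H k + complex_of_real t \<cdot>\<^sub>v v) = conjugate (col H k) + complex_of_real t \<cdot>\<^sub>v conjugate v"
      using h v by (simp add: conjugate_add_vec[of _ d] conjugate_smult_vec)
    then have "b k \<bullet>c (col H k + complex_of_real t \<cdot>\<^sub>v v) = b k \<bullet>c col H k + complex_of_real t * (b k \<bullet>c v)"
      using b[OF k] h v by (simp add: scalar_prod_add_distrib[of _ d])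
    then show ?thesis
      using hermitian_form_add[OF A_carrier A_adjoint h v, of t]
      unfolding True col q_def \<Delta>_def by (simp add: algebra_simps)
  next
    case False
    then have "col (H + V) l = col H l" using H l by (intro eq_vecI) (auto simp: V_def)
    with False show ?thesis by simp
  qed
  then have "(\<Sum>l<K. q l (col (H + V) l)) = (\<Sum>l<K. q l (col H l)) + \<Delta>"
    using k by (simp add: sum.distrib)
  moreover have fq: "f H' = C * exp (- (\<Sum>l<K. q l (col H' l)))" if "H' \<in> carrier_mat d K" for H'
    using f[OF that] by (simp add: q_def)
  ultimately have "f (H + V) = C * exp (- (\<Sum>l<K. q l (col H l)) + - \<Delta>)"
    using fq[of "H + V"] H V by (simp add: add.commute)
  then show ?thesis
    unfolding \<Delta>_def[symmetric] fq[OF H] by (simp only: exp_add mult.assoc)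
qed

text \<open>
  Translating column \<open>k\<close> by \<open>- (t / 2) v\<close> multiplies the density by
  \<open>exp (t X - e)\<close>, where \<open>X\<close> is the linear functional below and \<open>e\<close> is constant, while the
  total mass \<open>Z\<close> does not change.
\<close>

lemma mgf:
  assumes v: "v \<in> carrier_vec d" and k: "k < K"
  shows "(\<integral>\<^sup>+H. ennreal (exp (t * Re ((A *\<^sub>v v) \<bullet>c col H k))) \<partial>P) =
    ennreal (exp (t\<^sup>2 * Re ((A *\<^sub>v v) \<bullet>c v) / 4 + t * Re (b k \<bullet>c v)))"
proof -
  define X where "X H = Re ((A *\<^sub>v v) \<bullet>c col H k)" for H
  define e where "e = t\<^sup>2 * Re ((A *\<^sub>v v) \<bullet>c v) / 4 + t * Re (b k \<bullet>c v)"
  define V where "V = Matrix.mat d K (\<lambda>(i, l). if l = k then complex_of_real (- t / 2) * v $ i else 0)"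
  have V: "V \<in> carrier_mat d K" by (simp add: V_def)
  have X [measurable]: "X \<in> borel_measurable (lborel_mat d K)"
    unfolding X_def using A_carrier v k by (intro measurable_cscalar_col) auto
  note [measurable] = measurable_f
  have shift: "f (H + V) = exp (- e) * (f H * exp (t * X H))" if "H \<in> carrier_mat d K" for H
  proof -
    have "- (2 * (- t / 2) * X H + (- t / 2)\<^sup>2 * Re ((A *\<^sub>v v) \<bullet>c v) - 2 * (- t / 2) * Re (b k \<bullet>c v)) =
        - e + t * X H"
      by (simp add: e_def power2_eq_square field_simps)
    with f_translate[OF that v k, of "- t / 2"] have "f (H + V) = f H * exp (- e + t * X H)"
      unfolding V_def X_def by simp
    then show ?thesis by (simp only: exp_add) simp
  qed
  \<comment> \<open>Measurability of the translated density comes from the explicit formula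
    \<open>shift\<close>.\<close>
  have meas: "(\<lambda>H. ennreal (f (H + V))) \<in> borel_measurable (lborel_mat d K)"
    by (subst measurable_cong[where g = "\<lambda>H. ennreal (exp (- e) * (f H * exp (t * X H)))"])
      (auto simp: space_lborel_mat shift)
  have "Z = (\<integral>\<^sup>+H. ennreal (f (H + V)) \<partial>lborel_mat d K)"
    using nn_integral_lborel_mat_translate[of "\<lambda>H. ennreal (f H)", OF _ V meas] by simp
  also have "\<dots> = (\<integral>\<^sup>+H. ennreal (exp (- e)) * (ennreal (f H) * ennreal (exp (t * X H))) \<partial>lborel_mat d K)"
    by (intro nn_integral_cong)
      (auto simp: space_lborel_mat shift f_pos less_imp_le simp flip: ennreal_mult)
  also have "\<dots> = ennreal (exp (- e)) * (\<integral>\<^sup>+H. ennreal (f H) * ennreal (exp (t * X H)) \<partial>lborel_mat d K)"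
    by (rule nn_integral_cmult) auto
  finally have "ennreal (exp e) * Z = ennreal (exp e) * ennreal (exp (- e)) *
      (\<integral>\<^sup>+H. ennreal (f H) * ennreal (exp (t * X H)) \<partial>lborel_mat d K)"
    by (simp add: mult.assoc)
  also have "ennreal (exp e) * ennreal (exp (- e)) = 1"
    by (simp flip: ennreal_mult exp_add)
  finally have "(\<integral>\<^sup>+H. ennreal (exp (t * X H)) \<partial>P) = ennreal (exp e) * Z / Z"
    by (subst nn_integral_P) auto
  \<comment> \<open>Cancelling is legitimate because \<open>Z\<close> is neither 0 nor infinite; its
    value never enters.\<close>
  also have "\<dots> = ennreal (exp e)"
    using mass_nonzero finite_mass by (simp add: ennreal_mult_divide_eq)
  finally show ?thesis unfolding X_def e_def .
qed

lemma second_moment_direction: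
  assumes "v \<in> carrier_vec d" "k < K"
  shows "integrable P (\<lambda>H. (Re ((A *\<^sub>v v) \<bullet>c col H k))\<^sup>2)"
    "(\<integral>H. (Re ((A *\<^sub>v v) \<bullet>c col H k))\<^sup>2 \<partial>P) = Re ((A *\<^sub>v v) \<bullet>c v) / 2 + (Re (b k \<bullet>c v))\<^sup>2"
  using has_second_moment_of_mgf[OF prob_space_P _ mgf[OF assms]] measurable_cscalar_col[of "A *\<^sub>v v" k]
    A_carrier assms by auto

text \<open>The real and the imaginary part of an entry are both functionals covered by
  \<open>second_moment_direction\<close>. Each has variance half the diagonal entry of the inverse
  and has the corresponding part of the mean entry as its mean; adding the two second moments gives
  that of the modulus.\<close>

lemma second_moment:
  assumes j: "j < d" and k: "k < K"
  shows "integrable P (\<lambda>H. (cmod (H $$ (j, k)))\<^sup>2)"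
    "(\<integral>H. (cmod (H $$ (j, k)))\<^sup>2 \<partial>P) = (cmod ((mat_inv A *\<^sub>v b k) $ j))\<^sup>2 + Re (mat_inv A $$ (j, j))"
proof -
  let ?S = "mat_inv A"
  have S: "hermitian_pos_def d ?S" by (rule hermitian_pos_def_inverse[OF A])
  then have Sc: "?S \<in> carrier_mat d d" "mat_adjoint ?S = ?S" by (auto simp: hermitian_pos_def_def)
  note AS = hermitian_pos_def_inv(2)[OF A_carrier A]
  \<comment> \<open>With \<open>u = 1\<close> and \<open>u = \<i>\<close> the direction \<open>s u\<close> singles out the real and the imaginary part
    of the entry \<open>(j, k)\<close>.\<close>
  define s where "s u = u \<cdot>\<^sub>v (?S *\<^sub>v unit_vec d j)" for u :: complex
  have s: "s u \<in> carrier_vec d" for u using Sc by (auto simp: s_def)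
  have As: "A *\<^sub>v s u = u \<cdot>\<^sub>v unit_vec d j" for u
    using A_carrier Sc AS by (simp add: s_def mult_mat_vec[of _ d d] flip: assoc_mult_mat_vec[of _ d d _ d])
  have X: "(A *\<^sub>v s u) \<bullet>c h = u * cnj (h $ j)" if "h \<in> carrier_vec d" for h u
    unfolding As using that j by simp
  have Sjj: "(?S *\<^sub>v unit_vec d j) $ j = ?S $$ (j, j)" using Sc j by simp
  have Im_Sjj: "cnj (?S $$ (j, j)) = ?S $$ (j, j)"
    using mat_adjoint_index[of j ?S j] Sc j by simp
  have var: "(A *\<^sub>v s u) \<bullet>c s u = u * cnj u * ?S $$ (j, j)" for u
    unfolding X[OF s] using Sc j by (simp add: s_def Sjj Im_Sjj)
  \<comment> \<open>Self-adjointness moves the inverse from the direction onto \<open>b k\<close>,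
    which produces the mean vector.\<close>
  have mean: "b k \<bullet>c s u = cnj u * (?S *\<^sub>v b k) $ j" for u
  proof -
    have "b k \<bullet>c (?S *\<^sub>v unit_vec d j) = (?S *\<^sub>v b k) \<bullet>c unit_vec d j"
      using cscalar_mat_adjoint[OF Sc(1) b[OF k] unit_vec_carrier] Sc(2) by simp
    then show ?thesis
      using b[OF k] Sc j by (simp add: s_def conjugate_smult_vec conjugate_unit_vec)
  qed
  have col: "(A *\<^sub>v s u) \<bullet>c col H k = u * cnj (H $$ (j, k))" if "H \<in> carrier_mat d K" for H u
    using X[of "col H k" u] that j k by auto
  have moment: "integrable P (\<lambda>H. (Re (u * cnj (H $$ (j, k))))\<^sup>2)"
      "(\<integral>H. (Re (u * cnj (H $$ (j, k))))\<^sup>2 \<partial>P) = Re (u * cnj u * ?S $$ (j, j)) / 2 + (Re (cnj u * (?S *\<^sub>v b k) $ j))\<^sup>2" for u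
  proof -
    have "integrable P (\<lambda>H. (Re (u * cnj (H $$ (j, k))))\<^sup>2) \<longleftrightarrow> integrable P (\<lambda>H. (Re ((A *\<^sub>v s u) \<bullet>c col H k))\<^sup>2)"
      by (intro Bochner_Integration.integrable_cong refl) (simp add: space_lborel_mat col)
    then show "integrable P (\<lambda>H. (Re (u * cnj (H $$ (j, k))))\<^sup>2)"
      using second_moment_direction(1)[OF s k, of u] by blast
    have "(\<integral>H. (Re (u * cnj (H $$ (j, k))))\<^sup>2 \<partial>P) = (\<integral>H. (Re ((A *\<^sub>v s u) \<bullet>c col H k))\<^sup>2 \<partial>P)"
      by (intro Bochner_Integration.integral_cong refl) (simp add: space_lborel_mat col)
    then show "(\<integral>H. (Re (u * cnj (H $$ (j, k))))\<^sup>2 \<partial>P) = Re (u * cnj u * ?S $$ (j, j)) / 2 + (Re (cnj u * (?S *\<^sub>v b k) $ j))\<^sup>2"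
      by (simp only: second_moment_direction(2)[OF s k] mean var)
  qed
  have Re: "integrable P (\<lambda>H. (Re (H $$ (j, k)))\<^sup>2)"
      "(\<integral>H. (Re (H $$ (j, k)))\<^sup>2 \<partial>P) = Re (?S $$ (j, j)) / 2 + (Re ((?S *\<^sub>v b k) $ j))\<^sup>2"
    using moment[of 1] by simp_all
  have Im: "integrable P (\<lambda>H. (Im (H $$ (j, k)))\<^sup>2)"
      "(\<integral>H. (Im (H $$ (j, k)))\<^sup>2 \<partial>P) = Re (?S $$ (j, j)) / 2 + (Im ((?S *\<^sub>v b k) $ j))\<^sup>2"
    using moment[of \<i>] by simp_all
  show "integrable P (\<lambda>H. (cmod (H $$ (j, k)))\<^sup>2)"
    "(\<integral>H. (cmod (H $$ (j, k)))\<^sup>2 \<partial>P) = (cmod ((?S *\<^sub>v b k) $ j))\<^sup>2 + Re (?S $$ (j, j))"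
    using Re Im by (simp_all add: cmod_power2)
qed

text \<open>A diagonal entry is the value of the form of the inverse at a unit vector, and
  self-adjointness makes it real.\<close>

lemma covariance_diag_pos:
  assumes "j < d"
  shows "Re (mat_inv A $$ (j, j)) > 0" "Im (mat_inv A $$ (j, j)) = 0"
proof -
  have S: "hermitian_pos_def d (mat_inv A)" by (rule hermitian_pos_def_inverse[OF A])
  then have Sc: "mat_inv A \<in> carrier_mat d d" "mat_adjoint (mat_inv A) = mat_inv A"
    by (auto simp: hermitian_pos_def_def)
  have "unit_vec d j \<noteq> (0\<^sub>v d :: complex Matrix.vec)"
    using assms by (metis index_unit_vec(1) index_zero_vec(1) zero_neq_one)
  with S have "Re ((mat_inv A *\<^sub>v unit_vec d j) \<bullet>c unit_vec d j) > 0"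
    by (auto simp: hermitian_pos_def_def)
  then show "Re (mat_inv A $$ (j, j)) > 0"
    using Sc assms by (simp add: conjugate_unit_vec)
  have "cnj (mat_inv A $$ (j, j)) = mat_inv A $$ (j, j)"
    using mat_adjoint_index[of j "mat_inv A" j] Sc assms by simp
  then show "Im (mat_inv A $$ (j, j)) = 0" by (simp add: complex_eq_iff)
qed

section \<open>Integrability of quadratic polynomials in the entries\<close>

lemma integrable_entry_prod:
  assumes "i < d" "j < d" "k < K"
  shows "integrable P (\<lambda>H. H $$ (i, k) * cnj (H $$ (j, k)))"
proof (rule Bochner_Integration.integrable_bound)
  show "integrable P (\<lambda>H. (cmod (H $$ (i, k)))\<^sup>2 + (cmod (H $$ (j, k)))\<^sup>2)"
    using assms by (intro Bochner_Integration.integrable_add second_moment)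
  show "(\<lambda>H. H $$ (i, k) * cnj (H $$ (j, k))) \<in> borel_measurable P"
    using assms by (auto intro!: borel_measurable_times measurable_cnj measurable_lborel_mat_index)
  have "x * y \<le> x\<^sup>2 + y\<^sup>2" if "x \<ge> 0" "y \<ge> 0" for x y :: real
    using that sum_squares_bound[of x y] mult_nonneg_nonneg[of x y] by linarith
  then show "AE H in P. norm (H $$ (i, k) * cnj (H $$ (j, k))) \<le> norm ((cmod (H $$ (i, k)))\<^sup>2 + (cmod (H $$ (j, k)))\<^sup>2)"
    by (auto simp: norm_mult)
qed

lemma integrable_entry:
  assumes "j < d" "k < K"
  shows "integrable P (\<lambda>H. H $$ (j, k))"
proof (rule Bochner_Integration.integrable_bound)
  \<comment> \<open>Finiteness of the measure makes the constant 1 in the dominating function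
    integrable.\<close>
  interpret prob_space P by (rule prob_space_P)
  show "integrable P (\<lambda>H. 1 + (cmod (H $$ (j, k)))\<^sup>2)"
    using assms by (intro Bochner_Integration.integrable_add second_moment) auto
  show "(\<lambda>H. H $$ (j, k)) \<in> borel_measurable P"
    using assms measurable_lborel_mat_index[of _ d k K] by auto
  have "x \<le> 1 + x\<^sup>2" for x :: real
    using sum_squares_bound[of 1 x] by (cases "x \<ge> 0") (auto simp: add_nonneg_nonneg order.trans[of x 0])
  then show "AE H in P. norm (H $$ (j, k)) \<le> norm (1 + (cmod (H $$ (j, k)))\<^sup>2)" by auto
qed

text \<open>The matrix is arbitrary and need not be the precision \<open>A\<close>, since the
  application is to the quadratic part of the log likelihood alone.\<close>

lemma integrable_quadratic:
  assumes G: "G \<in> carrier_mat d d" and c: "c \<in> carrier_vec d" and k: "k < K"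
  shows "integrable P (\<lambda>H. Re ((G *\<^sub>v col H k) \<bullet>c col H k) - 2 * Re (c \<bullet>c col H k))"
proof -
  have "integrable P (\<lambda>H. Re (\<Sum>i = 0..<d. \<Sum>j = 0..<d. G $$ (i, j) * (H $$ (j, k) * cnj (H $$ (i, k)))) -
      2 * Re (\<Sum>i = 0..<d. c $ i * cnj (H $$ (i, k))))"
    using k by (intro Bochner_Integration.integrable_diff integrable_Re Bochner_Integration.integrable_sum
      integrable_mult_right integrable_entry_prod integrable_entry integrable_cnj) auto
  also have "?this \<longleftrightarrow> ?thesis"
    using G c k
    by (intro Bochner_Integration.integrable_cong refl)
      (auto simp: space_lborel_mat scalar_prod_def sum_distrib_right mult.assoc)
  finally show ?thesis .
qed

end

section \<open>The linear Gaussian model\<close>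

lemma kron_one_mat_diag:
  "1\<^sub>m a \<otimes>\<^sub>K mat_diag r g = mat_diag (a * r) (\<lambda>j. g (j mod r))"
proof (rule eq_matI)
  fix i j assume "i < dim_row (mat_diag (a * r) (\<lambda>j. g (j mod r)))" "j < dim_col (mat_diag (a * r) (\<lambda>j. g (j mod r)))"
  then have ij: "i < a * r" "j < a * r" by (auto simp: mat_diag_def)
  then have r: "r > 0" by (cases r) auto
  \<comment> \<open>Equal block number and equal position in the block mean equal index, so the
    nonzero entries lie exactly on the diagonal.\<close>
  have "i div r = j div r \<Longrightarrow> i mod r = j mod r \<Longrightarrow> i = j"
    by (metis div_mult_mod_eq)
  then show "(1\<^sub>m a \<otimes>\<^sub>K mat_diag r g) $$ (i, j) = mat_diag (a * r) (\<lambda>j. g (j mod r)) $$ (i, j)"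
    using ij r by (auto simp: kron_def mat_diag_def less_mult_imp_div_less)
qed (auto simp: kron_def mat_diag_def)

lemma Psi_J_eq_mat_diag:
  assumes "psi \<in> carrier_vec R"
  shows "Psi_J N M psi = mat_diag (N * M * R) (\<lambda>j. complex_of_real (psi $ (j mod R)))"
  using assms by (simp add: Psi_J_def kron_one_mat_diag mod_mod_cancel mult_ac)

lemma mat_inv_mat_diag:
  assumes "\<And>j. j < r \<Longrightarrow> g j \<noteq> 0"
  shows "mat_inv (mat_diag r g) = mat_diag r (\<lambda>j. inverse (g j))"
proof (rule mat_inv_eqI)
  show "mat_diag r g * mat_diag r (\<lambda>j. inverse (g j)) = 1\<^sub>m r"
    using assms by (auto simp: mat_diag_diag) (auto simp: mat_diag_def intro!: eq_matI)
qed auto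

lemma prod_lessThan_blocks:
  fixes g :: "nat \<Rightarrow> 'a::comm_monoid_mult"
  shows "(\<Prod>m<a. \<Prod>i<r. g (m * r + i)) = (\<Prod>j<a * r. g j)"
proof -
  have "(\<Prod>i<r. g (m * r + i)) = prod g {m * r..<m * r + r}" for m
    using prod.shift_bounds_nat_ivl[of g 0 "m * r" r] by (simp add: atLeast0LessThan add.commute)
  then show ?thesis by (simp add: prod.nat_group)
qed

text \<open>Block offsets are multiples of \<open>R\<close>, so the range bin of row
  \<open>j\<close> is \<open>j mod R\<close>, and the nested products over antennas and bins run
  once through all rows.\<close>

lemma prior_density_eq:
  assumes psi: "psi \<in> carrier_vec R" and H: "H \<in> carrier_mat (N * M * R) K"
  shows "prior_density N M psi H = (\<Prod>k<K. \<Prod>j<N * M * R. inverse (pi * psi $ (j mod R)) *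
    exp (- (cmod (H $$ (j, k)))\<^sup>2 / psi $ (j mod R)))"
proof -
  define g where "g = (\<lambda>k j. inverse (pi * psi $ (j mod R)) * exp (- (cmod (H $$ (j, k)))\<^sup>2 / psi $ (j mod R)))"
  have blocks: "(\<Prod>n<N. \<Prod>m<M. \<Prod>i<R. g k (m * (N * R) + n * R + i)) = (\<Prod>j<N * M * R. g k j)" for k
  proof -
    have "(\<Prod>n<N. \<Prod>m<M. \<Prod>i<R. g k (m * (N * R) + n * R + i)) =
        (\<Prod>m<M. \<Prod>n<N. \<Prod>i<R. g k (m * (N * R) + (n * R + i)))"
      by (subst prod.swap) (simp only: add.assoc)
    also have "\<dots> = (\<Prod>m<M. \<Prod>j<N * R. g k (m * (N * R) + j))"
      by (intro prod.cong refl prod_lessThan_blocks)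
    also have "\<dots> = (\<Prod>j<M * (N * R). g k j)"
      by (rule prod_lessThan_blocks)
    also have "M * (N * R) = N * M * R" by simp
    finally show ?thesis .
  qed
  have dims: "dim_vec psi = R" "dim_col H = K" using psi H by auto
  have g_block: "g k (m * (N * R) + n * R + i) = inverse (pi * psi $ i) *
      exp (- (cmod (H $$ (m * (N * R) + n * R + i, k)))\<^sup>2 / psi $ i)" if "i < R" for n m k i
  proof -
    have "m * (N * R) + n * R + i = i + (m * N + n) * R" by (simp add: algebra_simps)
    then have "(m * (N * R) + n * R + i) mod R = i" using that by (simp only: mod_mult_self1 mod_less)
    then show ?thesis by (simp only: g_def)
  qed
  have "prior_density N M psi H = (\<Prod>n<N. \<Prod>m<M. \<Prod>k<K. \<Prod>i<R. g k (m * (N * R) + n * R + i))"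
    unfolding prior_density_def Let_def dims by (intro prod.cong refl) (simp only: g_block lessThan_iff)
  also have "\<dots> = (\<Prod>n<N. \<Prod>k<K. \<Prod>m<M. \<Prod>i<R. g k (m * (N * R) + n * R + i))"
    by (intro prod.cong refl prod.swap)
  also have "\<dots> = (\<Prod>k<K. \<Prod>n<N. \<Prod>m<M. \<Prod>i<R. g k (m * (N * R) + n * R + i))"
    by (rule prod.swap)
  finally show ?thesis unfolding blocks by (simp only: g_def)
qed

lemma prior_density_pos:
  assumes "psi \<in> pos_vecs R"
  shows "prior_density N M psi H > 0"
  using assms unfolding prior_density_def Let_def
  by (intro prod_pos ballI mult_pos_pos) (auto simp: pos_vecs_def)

text \<open>Here the nested index structure is kept, because the update formula sums over it.
  Writing the prior as a single exponential makes the logarithm immediate.\<close>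

lemma ln_prior_density:
  assumes "psi \<in> pos_vecs R" "H \<in> carrier_mat d K"
  shows "ln (prior_density N M psi H) = (\<Sum>n<N. \<Sum>m<M. \<Sum>k<K. \<Sum>i<R.
    - ln (pi * psi $ i) - (cmod (H $$ (m * (N * R) + n * R + i, k)))\<^sup>2 / psi $ i)"
proof -
  have pos: "psi $ i > 0" if "i < R" for i using assms that by (auto simp: pos_vecs_def)
  have dims: "dim_vec psi = R" "dim_col H = K" using assms by (auto simp: pos_vecs_def)
  have term_exp: "inverse (pi * psi $ i) * exp (- (cmod z)\<^sup>2 / psi $ i) = exp (- ln (pi * psi $ i) - (cmod z)\<^sup>2 / psi $ i)"
    if "i < R" for i z
  proof -
    have "exp (- ln (pi * psi $ i)) = inverse (pi * psi $ i)"
      using pos[OF that] by (simp only: exp_minus exp_ln mult_pos_pos pi_gt_zero)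
    moreover have "- ln (pi * psi $ i) - (cmod z)\<^sup>2 / psi $ i = - ln (pi * psi $ i) + - (cmod z)\<^sup>2 / psi $ i"
      by simp
    ultimately show ?thesis by (simp only: exp_add)
  qed
  have "prior_density N M psi H = exp (\<Sum>n<N. \<Sum>m<M. \<Sum>k<K. \<Sum>i<R.
      - ln (pi * psi $ i) - (cmod (H $$ (m * (N * R) + n * R + i, k)))\<^sup>2 / psi $ i)"
    unfolding prior_density_def Let_def dims
    by (simp only: exp_sum finite_lessThan) (intro prod.cong refl, simp only: term_exp lessThan_iff)
  then show ?thesis by simp
qed

section \<open>Maximisation of a separable objective\<close>

lemma ln_add_divide_min:
  fixes a S x :: real
  assumes "a > 0" "S > 0" "x > 0"
  shows "a * ln (pi * (S / a)) + S / (S / a) \<le> a * ln (pi * x) + S / x"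
    and "x \<noteq> S / a \<Longrightarrow> a * ln (pi * (S / a)) + S / (S / a) < a * ln (pi * x) + S / x"
proof -
  \<comment> \<open>With \<open>u\<close> the ratio of the claimed minimiser to \<open>x\<close>,
    the difference of the two values is \<open>a * (u - 1 - ln u)\<close>. It is nonnegative, and
    zero only for \<open>u = 1\<close>.\<close>
  define u where "u = S / (a * x)"
  have u: "u > 0" using assms by (simp add: u_def)
  have "ln u = ln S - ln a - ln x" using assms by (simp add: u_def ln_div ln_mult)
  then have diff: "a * ln (pi * x) + S / x - (a * ln (pi * (S / a)) + S / (S / a)) = a * (u - 1 - ln u)"
    using assms by (simp add: ln_mult ln_div) (simp add: u_def field_simps)
  have "a * (u - 1 - ln u) \<ge> 0" using ln_le_minus_one[OF u] assms by simp
  with diff show "a * ln (pi * (S / a)) + S / (S / a) \<le> a * ln (pi * x) + S / x" by linarith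
  assume "x \<noteq> S / a"
  then have "u \<noteq> 1" using assms by (auto simp: u_def field_simps)
  then have "ln u \<noteq> u - 1" using ln_eq_minus_one[OF u] by blast
  then have "a * (u - 1 - ln u) > 0" using ln_le_minus_one[OF u] assms by simp
  with diff show "a * ln (pi * (S / a)) + S / (S / a) < a * ln (pi * x) + S / x" by linarith
qed

text \<open>Each coordinate is optimised separately. A competitor differs in some coordinate, where
  it loses strictly, while it gains in none; hence the maximiser is unique.\<close>

lemma is_arg_max_separable:
  fixes F :: "real Matrix.vec \<Rightarrow> real" and S :: "nat \<Rightarrow> real"
  assumes a: "a > 0" and S: "\<And>i. i < R \<Longrightarrow> S i > 0"
    and F: "\<And>psi. psi \<in> pos_vecs R \<Longrightarrow> F psi = c - (\<Sum>i<R. a * ln (pi * psi $ i) + S i / psi $ i)"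
  shows "{psi. is_arg_max F (\<lambda>psi. psi \<in> pos_vecs R) psi} = {Matrix.vec R (\<lambda>i. S i / a)}"
proof -
  let ?h = "Matrix.vec R (\<lambda>i. S i / a)"
  have h: "?h \<in> pos_vecs R" using a S by (auto simp: pos_vecs_def)
  have less: "F psi < F ?h" if psi: "psi \<in> pos_vecs R" "psi \<noteq> ?h" for psi
  proof -
    have "\<exists>i<R. psi $ i \<noteq> S i / a"
    proof (rule ccontr)
      assume "\<not> ?thesis"
      then have eq: "psi $ i = S i / a" if "i < R" for i using that by blast
      have "psi = ?h"
        by (rule eq_vecI) (use psi(1) in \<open>simp_all add: pos_vecs_def eq\<close>)
      with psi(2) show False by simp
    qed
    then obtain i where i: "i < R" "psi $ i \<noteq> S i / a" by blast
    have "(\<Sum>i<R. a * ln (pi * ?h $ i) + S i / ?h $ i) < (\<Sum>i<R. a * ln (pi * psi $ i) + S i / psi $ i)"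
    proof (rule sum_strict_mono_ex1)
      show "\<forall>i\<in>{..<R}. a * ln (pi * ?h $ i) + S i / ?h $ i \<le> a * ln (pi * psi $ i) + S i / psi $ i"
        using ln_add_divide_min(1)[OF a S] psi by (auto simp: pos_vecs_def)
      show "\<exists>i\<in>{..<R}. a * ln (pi * ?h $ i) + S i / ?h $ i < a * ln (pi * psi $ i) + S i / psi $ i"
        using ln_add_divide_min(2)[OF a S] psi i by (intro bexI[of _ i]) (auto simp: pos_vecs_def)
    qed simp
    then show ?thesis using F psi(1) h by simp
  qed
  have "is_arg_max F (\<lambda>psi. psi \<in> pos_vecs R) psi \<longleftrightarrow> psi = ?h" for psi
  proof
    assume "is_arg_max F (\<lambda>psi. psi \<in> pos_vecs R) psi"
    then have "psi \<in> pos_vecs R" "\<not> F psi < F ?h" using h by (auto simp only: is_arg_max_def)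
    then show "psi = ?h" using less by blast
  next
    assume psi: "psi = ?h"
    have "\<not> F ?h < F y" if "y \<in> pos_vecs R" for y
      using less[OF that] by (cases "y = ?h") (simp, metis less_asym)
    with h show "is_arg_max F (\<lambda>psi. psi \<in> pos_vecs R) psi"
      unfolding psi is_arg_max_def by blast
  qed
  then show ?thesis by blast
qed

section \<open>The observation model and its posterior as a matrix Gaussian\<close>

locale linear_gaussian_model =
  fixes N M R K p :: nat and X Rv Y :: "complex Matrix.mat" and psi0 :: "real Matrix.vec"
  assumes pos: "N > 0" "M > 0" "R > 0" "K > 0"
    and X: "X \<in> carrier_mat p (N * M * R)"
    and Rv: "hermitian_pos_def p Rv"
    and Y: "Y \<in> carrier_mat p K"
    and psi0: "psi0 \<in> pos_vecs R"
begin

abbreviation "d \<equiv> N * M * R"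
abbreviation "B \<equiv> mat_inv Rv"
text \<open>\<open>G\<close> and \<open>b\<close> are the quadratic and linear coefficients that the
  likelihood contributes to the exponent; adding the prior precision to \<open>G\<close> gives the
  posterior precision \<open>A\<close>.\<close>

definition "G = mat_adjoint X * B * X"
definition "A = G + mat_inv (Psi_J N M psi0)"
definition "b k = mat_adjoint X *\<^sub>v (B *\<^sub>v col Y k)"
definition "noise_const = 1 / (pi ^ p * Re (Determinant.det Rv))"

lemma psi_pos: "psi \<in> pos_vecs R \<Longrightarrow> psi $ (j mod R) > 0"
  using pos by (simp add: pos_vecs_def)

lemma B: "hermitian_pos_def p B" "B \<in> carrier_mat p p" "mat_adjoint B = B"
  using hermitian_pos_def_inverse[OF Rv] by (auto simp: hermitian_pos_def_def)

lemma G: "G \<in> carrier_mat d d"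
  using X B mat_adjoint_carrier[OF X] by (auto simp: G_def)

lemma b: "k < K \<Longrightarrow> b k \<in> carrier_vec d"
  using X B Y mat_adjoint_carrier[OF X] by (auto simp: b_def intro!: mult_mat_vec_carrier)

lemma A_eq: "A = G + mat_diag d (\<lambda>j. complex_of_real (inverse (psi0 $ (j mod R))))"
  using psi0 psi_pos[OF psi0]
  by (simp add: A_def Psi_J_eq_mat_diag[of _ R] mat_inv_mat_diag pos_vecs_def less_imp_neq[symmetric])

lemma A: "hermitian_pos_def d A"
  unfolding A_eq G_def using B(1) X psi_pos[OF psi0] by (intro hermitian_pos_def_gram_add_diag) auto

lemma noise_const_pos: "noise_const > 0"
  using hermitian_pos_def_det_pos[OF Rv] by (simp add: noise_const_def)

lemma col_residual:
  assumes "H \<in> carrier_mat d K" "k < K"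
  shows "col (Y - X * H) k = col Y k - X *\<^sub>v col H k"
  using assms X Y by (intro eq_vecI) (auto simp: scalar_prod_def)

lemma likelihood_eq:
  assumes H: "H \<in> carrier_mat d K"
  shows "likelihood X Rv Y H = noise_const ^ K *
    exp (- (\<Sum>k<K. Re ((B *\<^sub>v (col Y k - X *\<^sub>v col H k)) \<bullet>c (col Y k - X *\<^sub>v col H k))))"
proof -
  have "likelihood X Rv Y H = (\<Prod>k<K. cgauss_density Rv (col Y k - X *\<^sub>v col H k))"
    using H X Y by (simp add: likelihood_def noise_density_def col_residual)
  also have "\<dots> = (\<Prod>k<K. noise_const * exp (- Re ((B *\<^sub>v (col Y k - X *\<^sub>v col H k)) \<bullet>c (col Y k - X *\<^sub>v col H k))))"
    using H X Y by (intro prod.cong) (auto simp: cgauss_density_def noise_const_def)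
  finally show ?thesis by (simp add: prod.distrib exp_sum sum_negf[symmetric])
qed

text \<open>The residual form is nonnegative. The bound reduces finiteness of the evidence to
  integrability of the prior.\<close>

lemma likelihood_le:
  assumes H: "H \<in> carrier_mat d K"
  shows "likelihood X Rv Y H \<le> noise_const ^ K"
proof -
  have "Re ((B *\<^sub>v w) \<bullet>c w) \<ge> 0" if "w \<in> carrier_vec p" for w
    using B that by (cases "w = 0\<^sub>v p") (auto simp: hermitian_pos_def_def less_imp_le)
  then have "(\<Sum>k<K. Re ((B *\<^sub>v (col Y k - X *\<^sub>v col H k)) \<bullet>c (col Y k - X *\<^sub>v col H k))) \<ge> 0"
    using H X Y by (intro sum_nonneg) auto
  then show ?thesis
    unfolding likelihood_eq[OF H] using noise_const_pos by (intro mult_left_le) auto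
qed

lemma likelihood_pos: "H \<in> carrier_mat d K \<Longrightarrow> likelihood X Rv Y H > 0"
  using noise_const_pos by (simp add: likelihood_eq)

lemma residual_form:
  assumes "H \<in> carrier_mat d K" "k < K"
  shows "Re ((B *\<^sub>v (col Y k - X *\<^sub>v col H k)) \<bullet>c (col Y k - X *\<^sub>v col H k)) =
    Re ((B *\<^sub>v col Y k) \<bullet>c col Y k) + (Re ((G *\<^sub>v col H k) \<bullet>c col H k) - 2 * Re (b k \<bullet>c col H k))"
  using hermitian_form_residual[OF B(2,3) X, of "col Y k" "col H k"] assms X Y
  by (auto simp: G_def b_def)

lemma form_A:
  assumes h: "h \<in> carrier_vec d"
  shows "Re ((A *\<^sub>v h) \<bullet>c h) = Re ((G *\<^sub>v h) \<bullet>c h) + (\<Sum>j<d. (cmod (h $ j))\<^sup>2 / psi0 $ (j mod R))"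
proof -
  let ?D = "mat_diag d (\<lambda>j. complex_of_real (inverse (psi0 $ (j mod R))))"
  have "(A *\<^sub>v h) \<bullet>c h = (G *\<^sub>v h) \<bullet>c h + (?D *\<^sub>v h) \<bullet>c h"
  proof -
    have "A *\<^sub>v h = G *\<^sub>v h + ?D *\<^sub>v h" unfolding A_eq using G h by (intro add_mult_distrib_mat_vec) auto
    moreover have "G *\<^sub>v h \<in> carrier_vec d" "?D *\<^sub>v h \<in> carrier_vec d" "conjugate h \<in> carrier_vec d"
      using G h by (auto intro!: mult_mat_vec_carrier)
    ultimately show ?thesis by (simp only: add_scalar_prod_distrib)
  qed
  moreover have "Re ((?D *\<^sub>v h) \<bullet>c h) = (\<Sum>j<d. (cmod (h $ j))\<^sup>2 / psi0 $ (j mod R))"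
  proof -
    have "Re ((?D *\<^sub>v h) \<bullet>c h) = (\<Sum>j<d. inverse (psi0 $ (j mod R)) * (cmod (h $ j))\<^sup>2)"
      using mat_diag_form[OF h, of "\<lambda>j. inverse (psi0 $ (j mod R))"] by (simp only: Re_complex_of_real)
    also have "\<dots> = (\<Sum>j<d. (cmod (h $ j))\<^sup>2 / psi0 $ (j mod R))"
      by (intro sum.cong refl) (simp only: divide_inverse mult.commute)
    finally show ?thesis .
  qed
  ultimately show ?thesis by simp
qed

text \<open>This gathers the factors of the joint density that do not involve \<open>H\<close>; of
  its value only the sign is used.\<close>

definition "joint_const = noise_const ^ K * exp (- (\<Sum>k<K. Re ((B *\<^sub>v col Y k) \<bullet>c col Y k))) *
  (\<Prod>k<K. \<Prod>j<d. inverse (pi * psi0 $ (j mod R)))"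

lemma joint_density_eq:
  assumes H: "H \<in> carrier_mat d K"
  shows "joint_density N M X Rv psi0 Y H =
    joint_const * exp (- (\<Sum>k<K. Re ((A *\<^sub>v col H k) \<bullet>c col H k) - 2 * Re (b k \<bullet>c col H k)))"
proof -
  let ?r = "\<lambda>k. Re ((B *\<^sub>v col Y k) \<bullet>c col Y k)"
  let ?g = "\<lambda>k. Re ((G *\<^sub>v col H k) \<bullet>c col H k) - 2 * Re (b k \<bullet>c col H k)"
  let ?s = "\<lambda>k. \<Sum>j<d. (cmod (H $$ (j, k)))\<^sup>2 / psi0 $ (j mod R)"
  have "prior_density N M psi0 H =
      (\<Prod>k<K. \<Prod>j<d. inverse (pi * psi0 $ (j mod R))) * exp (- (\<Sum>k<K. ?s k))"
    using psi0 pos by (subst prior_density_eq[OF _ H]) (auto simp: pos_vecs_def prod.distrib exp_sum simp flip: sum_negf)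
  moreover have "likelihood X Rv Y H = noise_const ^ K * exp (- (\<Sum>k<K. ?r k + ?g k))"
    unfolding likelihood_eq[OF H] by (simp add: residual_form[OF H])
  moreover have "exp (- (\<Sum>k<K. ?r k + ?g k)) = exp (- (\<Sum>k<K. ?r k)) * exp (- (\<Sum>k<K. ?g k))"
    by (simp only: sum.distrib minus_add_distrib exp_add)
  ultimately have "joint_density N M X Rv psi0 Y H = joint_const * exp (- (\<Sum>k<K. ?g k) + - (\<Sum>k<K. ?s k))"
    by (simp only: joint_density_def joint_const_def exp_add mult_ac)
  also have "- (\<Sum>k<K. ?g k) + - (\<Sum>k<K. ?s k) =
      - (\<Sum>k<K. Re ((A *\<^sub>v col H k) \<bullet>c col H k) - 2 * Re (b k \<bullet>c col H k))"
  proof -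
    have "Re ((A *\<^sub>v col H k) \<bullet>c col H k) = Re ((G *\<^sub>v col H k) \<bullet>c col H k) + ?s k" if "k < K" for k
      using form_A[of "col H k"] H that by auto
    then show ?thesis by (simp add: sum.distrib sum_subtractf)
  qed
  finally show ?thesis .
qed

lemma joint_const_pos: "joint_const > 0"
  unfolding joint_const_def using noise_const_pos psi_pos[OF psi0]
  by (intro mult_pos_pos prod_pos ballI) auto

text \<open>After bounding the likelihood by a constant, what remains is the prior, a product over
  the entries of scaled complex Gaussians, each with finite integral.\<close>

lemma finite_mass: "(\<integral>\<^sup>+H. ennreal (joint_density N M X Rv psi0 Y H) \<partial>lborel_mat d K) < \<infinity>"
proof -
  let ?I = "{0..<d} \<times> {0..<K}"
  define g where "g = (\<lambda>(j, k :: nat) z. ennreal (inverse (pi * psi0 $ (j mod R)) * exp (- (cmod z)\<^sup>2 / psi0 $ (j mod R))))"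
  have g: "g q \<in> borel_measurable borel" for q by (auto simp: g_def split: prod.split)
  have prior: "ennreal (prior_density N M psi0 H) = (\<Prod>q\<in>?I. g q (H $$ q))" if "H \<in> carrier_mat d K" for H
  proof -
    have "(\<Prod>q\<in>?I. g q (H $$ q)) = (\<Prod>j<d. \<Prod>k<K. g (j, k) (H $$ (j, k)))"
      by (simp add: prod.cartesian_product atLeast0LessThan case_prod_unfold)
    also have "\<dots> = (\<Prod>k<K. \<Prod>j<d. g (j, k) (H $$ (j, k)))" by (rule prod.swap)
    also have "\<dots> = ennreal (prior_density N M psi0 H)"
      using psi0 pos psi_pos[OF psi0] that
      by (simp add: prior_density_eq[of _ R _ N M K] pos_vecs_def g_def prod_ennreal less_imp_le prod_nonneg)
    finally show ?thesis ..
  qed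
  have "(\<integral>\<^sup>+H. ennreal (joint_density N M X Rv psi0 Y H) \<partial>lborel_mat d K) \<le>
      (\<integral>\<^sup>+H. ennreal (noise_const ^ K) * (\<Prod>q\<in>?I. g q (H $$ q)) \<partial>lborel_mat d K)"
  proof (rule nn_integral_mono)
    fix H assume "H \<in> space (lborel_mat d K)"
    then have H: "H \<in> carrier_mat d K" by (simp add: space_lborel_mat)
    have "joint_density N M X Rv psi0 Y H \<le> noise_const ^ K * prior_density N M psi0 H"
      unfolding joint_density_def using likelihood_le[OF H] prior_density_pos[OF psi0]
      by (intro mult_right_mono) (auto simp: less_imp_le)
    then show "ennreal (joint_density N M X Rv psi0 Y H) \<le> ennreal (noise_const ^ K) * (\<Prod>q\<in>?I. g q (H $$ q))"
      unfolding prior[OF H, symmetric] using noise_const_pos prior_density_pos[OF psi0]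
      by (auto simp: less_imp_le simp flip: ennreal_mult intro!: ennreal_leI)
  qed
  also have "\<dots> = ennreal (noise_const ^ K) * (\<Prod>q\<in>?I. \<integral>\<^sup>+z. g q z \<partial>lborel)"
    using g
    by (subst nn_integral_cmult) (auto simp: nn_integral_lborel_mat_prod
      intro!: borel_measurable_prod_ennreal measurable_compose[OF measurable_lborel_mat_index g])
  also have "\<dots> < \<infinity>"
  proof -
    have "(\<integral>\<^sup>+z. g q z \<partial>lborel) < \<infinity>" if "q \<in> ?I" for q
    proof -
      obtain j k where q: "q = (j, k)" by (cases q)
      have p: "psi0 $ (j mod R) > 0" by (rule psi_pos[OF psi0])
      have "(\<integral>\<^sup>+z. g q z \<partial>lborel) = (\<integral>\<^sup>+z. ennreal (inverse (pi * psi0 $ (j mod R))) * ennreal (exp (- (cmod z)\<^sup>2 / psi0 $ (j mod R))) \<partial>lborel)"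
        using p by (intro nn_integral_cong) (simp add: q g_def ennreal_mult)
      also have "\<dots> = ennreal (inverse (pi * psi0 $ (j mod R))) * (\<integral>\<^sup>+z. ennreal (exp (- (cmod z)\<^sup>2 / psi0 $ (j mod R))) \<partial>lborel)"
        by (rule nn_integral_cmult) auto
      also have "\<dots> < \<infinity>"
        using nn_integral_complex_gaussian_finite[OF p] by (auto simp: ennreal_mult_less_top)
      finally show ?thesis .
    qed
    then have "(\<Prod>q\<in>?I. \<integral>\<^sup>+z. g q z \<partial>lborel) < \<infinity>"
      by (simp add: less_top[symmetric] ennreal_prod_eq_top)
    then show ?thesis by (auto simp: ennreal_mult_less_top)
  qed
  finally show ?thesis .
qed

text \<open>As a function of \<open>H\<close> the joint density is an unnormalised matrix Gaussian,
  so the moment formulas become available for the posterior.\<close>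

sublocale matrix_gaussian d K "joint_density N M X Rv psi0 Y" A b joint_const
  using A b joint_const_pos joint_density_eq finite_mass by unfold_locales auto

section \<open>From posterior moments to the EM objective and its maximiser\<close>

lemma posterior_eq: "posterior N M X Rv psi0 Y = P"
proof -
  have "dim_vec psi0 = R" "dim_col Y = K" using psi0 Y by (auto simp: pos_vecs_def)
  then show ?thesis by (simp only: posterior_def evidence_def)
qed

definition "second_mom j k = (cmod ((mat_inv A *\<^sub>v b k) $ j))\<^sup>2 + Re (mat_inv A $$ (j, j))"

lemma second_mom_pos: "j < d \<Longrightarrow> second_mom j k > 0"
  using covariance_diag_pos(1) by (simp add: second_mom_def add_nonneg_pos)

lemma block_index_less: "m < M \<Longrightarrow> n < N \<Longrightarrow> i < R \<Longrightarrow> m * (N * R) + n * R + i < d"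
proof -
  assume *: "m < M" "n < N" "i < R"
  have "n * R + i < N * R" using mult_le_mono1[of "Suc n" N R] * by simp
  moreover have "m * (N * R) + N * R \<le> M * (N * R)" using mult_le_mono1[of "Suc m" M "N * R"] * by simp
  ultimately show ?thesis by (simp add: mult_ac)
qed

text \<open>The logarithm is a quadratic polynomial in the entries of \<open>H\<close>.
  Integrability allows the hyperparameter-free part of the objective to be split off as an additive
  constant.\<close>

lemma ln_likelihood_integrable: "integrable P (\<lambda>H. ln (likelihood X Rv Y H))"
proof -
  interpret prob_space P by (rule prob_space_P)
  have "integrable P (\<lambda>H. ln (noise_const ^ K) - (\<Sum>k<K. Re ((B *\<^sub>v col Y k) \<bullet>c col Y k) +
      (Re ((G *\<^sub>v col H k) \<bullet>c col H k) - 2 * Re (b k \<bullet>c col H k))))"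
    using G b by (intro Bochner_Integration.integrable_diff Bochner_Integration.integrable_sum
      Bochner_Integration.integrable_add integrable_quadratic integrable_const) auto
  also have "?this \<longleftrightarrow> ?thesis"
    using noise_const_pos
    by (intro Bochner_Integration.integrable_cong refl)
      (simp add: space_lborel_mat likelihood_eq residual_form ln_mult)
  finally show ?thesis .
qed

lemma ln_prior_has_integral:
  assumes psi: "psi \<in> pos_vecs R"
  shows "has_bochner_integral P (\<lambda>H. ln (prior_density N M psi H))
    (\<Sum>n<N. \<Sum>m<M. \<Sum>k<K. \<Sum>i<R. - ln (pi * psi $ i) - second_mom (m * (N * R) + n * R + i) k / psi $ i)"
proof -
  interpret prob_space P by (rule prob_space_P)
  have "has_bochner_integral P (\<lambda>H. - ln (pi * psi $ i) - (cmod (H $$ (m * (N * R) + n * R + i, k)))\<^sup>2 / psi $ i)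
      (- ln (pi * psi $ i) - second_mom (m * (N * R) + n * R + i) k / psi $ i)"
    if "m < M" "n < N" "i < R" "k < K" for m n i k
  proof -
    note sm = second_moment[OF block_index_less[OF that(1-3)] that(4)]
    have "has_bochner_integral P (\<lambda>H. - ln (pi * psi $ i)) (- ln (pi * psi $ i))"
      using prob_space by (simp add: has_bochner_integral_iff)
    moreover have "has_bochner_integral P (\<lambda>H. (cmod (H $$ (m * (N * R) + n * R + i, k)))\<^sup>2)
        (second_mom (m * (N * R) + n * R + i) k)"
      using sm by (simp add: has_bochner_integral_iff second_mom_def)
    ultimately show ?thesis
      by (intro has_bochner_integral_diff has_bochner_integral_divide_zero) auto
  qed
  then have "has_bochner_integral P
      (\<lambda>H. \<Sum>n<N. \<Sum>m<M. \<Sum>k<K. \<Sum>i<R. - ln (pi * psi $ i) - (cmod (H $$ (m * (N * R) + n * R + i, k)))\<^sup>2 / psi $ i)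
      (\<Sum>n<N. \<Sum>m<M. \<Sum>k<K. \<Sum>i<R. - ln (pi * psi $ i) - second_mom (m * (N * R) + n * R + i) k / psi $ i)"
    by (intro has_bochner_integral_sum) auto
  then show ?thesis
    by (rule has_bochner_integral_cong[THEN iffD1, rotated 3])
      (auto simp: space_lborel_mat ln_prior_density[OF psi])
qed

lemma ln_joint_density:
  assumes "psi \<in> pos_vecs R" "H \<in> carrier_mat d K"
  shows "ln (joint_density N M X Rv psi Y H) = ln (likelihood X Rv Y H) + ln (prior_density N M psi H)"
  unfolding joint_density_def
  by (rule ln_mult_pos[OF likelihood_pos[OF assms(2)] prior_density_pos[OF assms(1)]])

lemma ln_joint_density_has_integral:
  assumes psi: "psi \<in> pos_vecs R"
  shows "has_bochner_integral P (\<lambda>H. ln (joint_density N M X Rv psi Y H))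
    ((\<integral>H. ln (likelihood X Rv Y H) \<partial>P) +
    (\<Sum>n<N. \<Sum>m<M. \<Sum>k<K. \<Sum>i<R. - ln (pi * psi $ i) - second_mom (m * (N * R) + n * R + i) k / psi $ i))"
proof -
  have "has_bochner_integral P (\<lambda>H. ln (likelihood X Rv Y H) + ln (prior_density N M psi H))
    ((\<integral>H. ln (likelihood X Rv Y H) \<partial>P) +
    (\<Sum>n<N. \<Sum>m<M. \<Sum>k<K. \<Sum>i<R. - ln (pi * psi $ i) - second_mom (m * (N * R) + n * R + i) k / psi $ i))"
    using ln_likelihood_integrable by (intro has_bochner_integral_add ln_prior_has_integral[OF psi] has_bochner_integral_integrable)
  then show ?thesis
    by (rule has_bochner_integral_cong[THEN iffD1, rotated 3])
      (auto simp: space_lborel_mat ln_joint_density[OF psi])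
qed

definition "total_mom i = (\<Sum>n<N. \<Sum>m<M. \<Sum>k<K. second_mom (m * (N * R) + n * R + i) k)"

lemma em_objective_eq:
  assumes psi: "psi \<in> pos_vecs R"
  shows "em_objective N M X Rv Y psi0 psi = (\<integral>H. ln (likelihood X Rv Y H) \<partial>P) -
    (\<Sum>i<R. real (N * M * K) * ln (pi * psi $ i) + total_mom i / psi $ i)"
proof -
  let ?t = "\<lambda>n m k i. - ln (pi * psi $ i) - second_mom (m * (N * R) + n * R + i) k / psi $ i"
  \<comment> \<open>The sum over range bins is moved outermost; within one bin the logarithmic term
    occurs once for each of the \<open>N * M * K\<close> triples.\<close>
  have "(\<Sum>n<N. \<Sum>m<M. \<Sum>k<K. \<Sum>i<R. ?t n m k i) = (\<Sum>n<N. \<Sum>m<M. \<Sum>i<R. \<Sum>k<K. ?t n m k i)"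
    by (intro sum.cong refl sum.swap)
  also have "\<dots> = (\<Sum>n<N. \<Sum>i<R. \<Sum>m<M. \<Sum>k<K. ?t n m k i)"
    by (intro sum.cong refl sum.swap)
  also have "\<dots> = (\<Sum>i<R. \<Sum>n<N. \<Sum>m<M. \<Sum>k<K. ?t n m k i)"
    by (rule sum.swap)
  also have "\<dots> = (\<Sum>i<R. - (real (N * M * K) * ln (pi * psi $ i) + total_mom i / psi $ i))"
    by (simp add: total_mom_def sum_subtractf sum_divide_distrib sum_negf mult.assoc)
  also have "\<dots> = - (\<Sum>i<R. real (N * M * K) * ln (pi * psi $ i) + total_mom i / psi $ i)"
    by (rule sum_negf)
  finally show ?thesis
    using ln_joint_density_has_integral[OF psi]
    by (simp add: em_objective_def posterior_eq has_bochner_integral_iff)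
qed

text \<open>The sums are nonempty with positive terms, which keeps the stationary point inside the
  open positive orthant.\<close>

lemma total_mom_pos: "i < R \<Longrightarrow> total_mom i > 0"
  unfolding total_mom_def using pos
  by (intro sum_pos second_mom_pos block_index_less) auto

lemma em_arg_max:
  "{psi. is_arg_max (em_objective N M X Rv Y psi0) (\<lambda>psi. psi \<in> pos_vecs R) psi} =
    {Matrix.vec R (\<lambda>i. total_mom i / real (N * M * K))}"
  by (rule is_arg_max_separable[OF _ total_mom_pos em_objective_eq]) (use pos in simp)

text \<open>The covariance part does not vary with the pulse, so summing over \<open>k\<close>
  yields a factor \<open>K\<close> that cancels against the denominator. The identity is between
  complex numbers because the covariance is a complex matrix; its diagonal is real.\<close>

lemma total_mom_divide:
  assumes i: "i < R"
  shows "complex_of_real (total_mom i / real (N * M * K)) =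
    1 / of_nat (N * M * K) * (\<Sum>n<N. \<Sum>m<M. \<Sum>k<K.
      complex_of_real ((cmod ((mat_inv A *\<^sub>v b k) $ (m * (N * R) + n * R + i)))\<^sup>2)) +
    1 / of_nat (N * M) * (\<Sum>n<N. \<Sum>m<M. mat_inv A $$ (m * (N * R) + n * R + i, m * (N * R) + n * R + i))"
proof -
  let ?j = "\<lambda>n m. m * (N * R) + n * R + i"
  have diag: "complex_of_real (Re (mat_inv A $$ (?j n m, ?j n m))) = mat_inv A $$ (?j n m, ?j n m)"
    if "n < N" "m < M" for n m
    using covariance_diag_pos(2)[OF block_index_less[OF that(2,1) i]] by (simp add: complex_eq_iff)
  have "complex_of_real (total_mom i) =
      (\<Sum>n<N. \<Sum>m<M. \<Sum>k<K. complex_of_real ((cmod ((mat_inv A *\<^sub>v b k) $ ?j n m))\<^sup>2)) +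
      of_nat K * (\<Sum>n<N. \<Sum>m<M. mat_inv A $$ (?j n m, ?j n m))"
  proof -
    have "total_mom i = (\<Sum>n<N. \<Sum>m<M. \<Sum>k<K. (cmod ((mat_inv A *\<^sub>v b k) $ ?j n m))\<^sup>2) +
        (\<Sum>n<N. \<Sum>m<M. real K * Re (mat_inv A $$ (?j n m, ?j n m)))"
      by (simp add: total_mom_def second_mom_def sum.distrib)
    moreover have "complex_of_real (\<Sum>n<N. \<Sum>m<M. real K * Re (mat_inv A $$ (?j n m, ?j n m))) =
        (\<Sum>n<N. \<Sum>m<M. of_nat K * mat_inv A $$ (?j n m, ?j n m))"
      unfolding of_real_sum of_real_mult of_real_of_nat_eq
      by (intro sum.cong refl) (simp only: diag lessThan_iff)
    ultimately show ?thesis by (simp only: of_real_add of_real_sum sum_distrib_left)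
  qed
  moreover have "(s + of_nat K * t) / of_nat (N * M * K) = 1 / of_nat (N * M * K) * s + 1 / of_nat (N * M) * t"
    for s t :: complex
    using pos by (simp add: add_divide_distrib)
  ultimately show ?thesis by (simp only: of_real_divide of_real_of_nat_eq)
qed

text \<open>Reassociating the product to the right lets the column operator pass through every
  factor down to the \<open>k\<close>-th column of \<open>Y\<close>.\<close>

lemma posterior_mean_index:
  assumes "j < d" "k < K"
  shows "(mat_inv A * mat_adjoint X * B * Y) $$ (j, k) = (mat_inv A *\<^sub>v b k) $ j"
proof -
  note X' = mat_adjoint_carrier[OF X]
  have S: "mat_inv A \<in> carrier_mat d d" by (rule hermitian_pos_def_inv(1)[OF A_carrier A])
  have "mat_inv A * mat_adjoint X * B * Y = mat_inv A * (mat_adjoint X * (B * Y))"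
    using S X' B Y by (simp add: assoc_mult_mat[of _ d d _ p] assoc_mult_mat[of _ d p _ p])
  moreover have "(mat_inv A * (mat_adjoint X * (B * Y))) $$ (j, k) = col (mat_inv A * (mat_adjoint X * (B * Y))) k $ j"
    using S Y assms by (subst index_col) auto
  moreover have "col (mat_inv A * (mat_adjoint X * (B * Y))) k = mat_inv A *\<^sub>v b k"
    unfolding b_def
    by (simp only: col_mult2[OF S mult_carrier_mat[OF X' mult_carrier_mat[OF B(2) Y]] assms(2)]
      col_mult2[OF X' mult_carrier_mat[OF B(2) Y] assms(2)] col_mult2[OF B(2) Y assms(2)])
  ultimately show ?thesis by (simp only:)
qed

end

text \<open>The first two conjuncts certify that the objective is a genuine expectation. Stating the
  set of maximisers as a singleton asserts existence and uniqueness together.\<close>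

theorem theorem2:
  fixes N M R K L :: nat
    and x :: "nat \<Rightarrow> nat \<Rightarrow> complex"
    and Xt Rv Y Sigma Mu :: "complex Matrix.mat"
    and psi_prev :: "real Matrix.vec"
  assumes "N > 0" "M > 0" "R > 0" "K > 0" "L > 0"
    and "Xt = 1\<^sub>m M \<otimes>\<^sub>K transmit_mat N R L x"
    and "hermitian_pos_def (M * (L + R - 1)) Rv"
    and "Y \<in> carrier_mat (M * (L + R - 1)) K"
    and "psi_prev \<in> pos_vecs R"
    and "Sigma = mat_inv (mat_adjoint Xt * mat_inv Rv * Xt + mat_inv (Psi_J N M psi_prev))"
    and "Mu = Sigma * mat_adjoint Xt * mat_inv Rv * Y"
  shows "prob_space (posterior N M Xt Rv psi_prev Y) \<and>
         (\<forall>psi \<in> pos_vecs R.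
           integrable (posterior N M Xt Rv psi_prev Y) (\<lambda>H. ln (joint_density N M Xt Rv psi Y H))) \<and>
         (\<exists>psi_hat.
           {psi. is_arg_max (em_objective N M Xt Rv Y psi_prev) (\<lambda>psi. psi \<in> pos_vecs R) psi} = {psi_hat} \<and>
           (\<forall>i < R. complex_of_real (psi_hat $ i) =
              1 / of_nat (N * M * K) *
                (\<Sum>n < N. \<Sum>m < M. \<Sum>k < K.
                   complex_of_real ((cmod (Mu $$ (m * (N * R) + n * R + i, k)))\<^sup>2)) +
              1 / of_nat (N * M) *
                (\<Sum>n < N. \<Sum>m < M.
                   Sigma $$ (m * (N * R) + n * R + i, m * (N * R) + n * R + i))))"
proof -
  have Xt: "Xt \<in> carrier_mat (M * (L + R - 1)) (N * M * R)"
  proof -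
    have "N * M * R = M * (N * R)" by simp
    then show ?thesis
      unfolding assms(6) by (intro carrier_matI) (simp_all add: kron_def transmit_mat_def)
  qed
  interpret linear_gaussian_model N M R K "M * (L + R - 1)" Xt Rv Y psi_prev
    by (rule linear_gaussian_model.intro) (fact assms Xt)+
  have Sigma: "Sigma = mat_inv A" unfolding A_def G_def by (rule assms(10))
  have Mu: "Mu $$ (m * (N * R) + n * R + i, k) = (mat_inv A *\<^sub>v b k) $ (m * (N * R) + n * R + i)"
    if "m < M" "n < N" "i < R" "k < K" for m n i k
    unfolding assms(11) Sigma by (rule posterior_mean_index[OF block_index_less[OF that(1-3)] that(4)])
  \<comment> \<open>A Bochner integral of a non-integrable function would be 0 by convention, so
    integrability is recorded separately for every candidate \<open>psi\<close>.\<close>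
  have int: "integrable P (\<lambda>H. ln (joint_density N M Xt Rv psi Y H))" if "psi \<in> pos_vecs R" for psi
    using ln_joint_density_has_integral[OF that] by (simp add: has_bochner_integral_iff)
  have formula: "complex_of_real (Matrix.vec R (\<lambda>i. total_mom i / real (N * M * K)) $ i) =
      1 / of_nat (N * M * K) * (\<Sum>n<N. \<Sum>m<M. \<Sum>k<K.
        complex_of_real ((cmod (Mu $$ (m * (N * R) + n * R + i, k)))\<^sup>2)) +
      1 / of_nat (N * M) * (\<Sum>n<N. \<Sum>m<M. Sigma $$ (m * (N * R) + n * R + i, m * (N * R) + n * R + i))"
    if i: "i < R" for i
  proof -
    have "(\<Sum>n<N. \<Sum>m<M. \<Sum>k<K. complex_of_real ((cmod (Mu $$ (m * (N * R) + n * R + i, k)))\<^sup>2)) =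
        (\<Sum>n<N. \<Sum>m<M. \<Sum>k<K. complex_of_real ((cmod ((mat_inv A *\<^sub>v b k) $ (m * (N * R) + n * R + i)))\<^sup>2))"
      by (intro sum.cong refl) (simp only: Mu i lessThan_iff)
    then show ?thesis
      unfolding Sigma index_vec[OF i] total_mom_divide[OF i] by (simp only:)
  qed
  show ?thesis
    unfolding posterior_eq
  proof (intro conjI)
    show "prob_space P" by (rule prob_space_P)
    show "\<forall>psi\<in>pos_vecs R. integrable P (\<lambda>H. ln (joint_density N M Xt Rv psi Y H))"
      using int by (rule ballI)
  qed (rule exI, rule conjI, rule em_arg_max, intro allI impI, rule formula)
qed

end
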